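(* Suppose Assumptions A1, A2, A3 (stated in the context) hold, and that: (i) for some $k_1,k_2>0$, $\|\phi(x)\|\le k_1e^{k_2|x|}$ for all $x\in\mathbb{R}$; (ii) there exists a number $L>0$ such that, for $S_L:=\{x\in\mathbb{R}:\|\phi(x)\|\le L\}$, $$\liminf_{l\to+\infty}\frac{\ell(S_L\cap[-l,l])}{l}>0,$$ where $\ell$ denotes the Lebesgue measure. Then the system $$y_{t+1}=\theta^\tau\phi(y_t)+u_t+w_{t+1},\quad t\ge0,$$ is almost surely globally stabilizable.
   Context: Setting: $n\ge2$; $\theta=(\theta_1,\ldots,\theta_n)^\tau\in\mathbb{R}^n$ is an unknown (random) parameter vector; $y_t,u_t,w_t\in\mathbb{R}$ are the output, input and noise signals; $\phi=(f_1,\ldots,f_n)^\tau:\mathbb{R}\to\mathbb{R}^n$ is a known measurable vector function, and $E\subset\mathbb{R}$ is an open set such that $f_j\in C^n(E)$ for $1\le j\le n$. $\|\cdot\|$ is the Euclidean norm. Assumptions. A1: $\{w_t\}$ is an i.i.d. random sequence with $w_1\sim N(0,\sigma^2)$, $\sigma>0$. A2: $\theta\sim N(\theta_0,I_n)$ is independent of $\{w_t\}$. A3: $f_1,\ldots,f_n$ are linearly independent on $E$. Definition: the system is almost surely globally stabilizable if there exists a feedback control law $u_t\in\mathcal{F}_t^y:=\sigma\{y_i,0\le i\le t\}$, $t=0,1,\ldots$ (i.e. $u_t$ is $\mathcal{F}_t^y$-measurable), such that for any initial condition $y_0\in\mathbb{R}$, $\sup_{t\ge1}\frac1t\sum_{i=1}^ty_i^2<+\infty$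 almost surely. *)

theory Defs
  imports "HOL-Probability.Probability"
begin

definition C_k_on :: "nat \<Rightarrow> (real \<Rightarrow> real) \<Rightarrow> real set \<Rightarrow> bool" where
  "C_k_on k f E \<longleftrightarrow>
     (\<forall>i<k. \<forall>x\<in>E. ((deriv ^^ i) f has_real_derivative (deriv ^^ Suc i) f x) (at x)) \<and>
     continuous_on E ((deriv ^^ k) f)"

text \<open>The components of \<open>\<phi>\<close>, restricted to \<open>E\<close>, are linearly independent functions.\<close>

definition components_lin_indep_on :: "(real \<Rightarrow> real ^ 'n) \<Rightarrow> real set \<Rightarrow> bool" where
  "components_lin_indep_on \<phi> E \<longleftrightarrow>
     (\<forall>c :: real ^ 'n. (\<forall>x\<in>E. (\<Sum>j\<in>UNIV. c $ j * \<phi> x $ j) = 0) \<longrightarrow> c = 0)"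

definition std_cov_normal_density :: "real ^ 'n \<Rightarrow> real ^ 'n \<Rightarrow> real" where
  "std_cov_normal_density \<mu> x =
     (2 * pi) powr (- real CARD('n) / 2) * exp (- (norm (x - \<mu>))\<^sup>2 / 2)"

definition generated_sigma ::
    "'a measure \<Rightarrow> 'i set \<Rightarrow> ('i \<Rightarrow> 'a \<Rightarrow> 'b::topological_space) \<Rightarrow> 'a measure" where
  "generated_sigma M I X =
     sigma (space M) (\<Union>i\<in>I. {X i -` A \<inter> space M | A. A \<in> sets borel})"

text \<open>The noise enters the system only through \<open>w\<^sub>1, w\<^sub>2, \<dots>\<close>, so the sequence is indexed by
  \<open>t \<ge> 1\<close>; the value of \<open>w\<close> at \<open>0\<close> is junk.\<close>

definition iid_gaussian_noise :: "'a measure \<Rightarrow> real \<Rightarrow> (nat \<Rightarrow> 'a \<Rightarrow> real) \<Rightarrow> bool" where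
  "iid_gaussian_noise M \<sigma> w \<longleftrightarrow>
     prob_space.indep_vars M (\<lambda>_. borel) w {1..} \<and>
     (\<forall>t\<ge>1. distr M borel (w t) = distr M borel (w 1)) \<and>
     distributed M lborel (w 1) (\<lambda>x. ennreal (normal_density 0 \<sigma> x))"

definition gaussian_parameter ::
    "'a measure \<Rightarrow> real ^ 'n \<Rightarrow> ('a \<Rightarrow> real ^ 'n) \<Rightarrow> (nat \<Rightarrow> 'a \<Rightarrow> real) \<Rightarrow> bool" where
  "gaussian_parameter M \<theta>0 \<theta> w \<longleftrightarrow>
     distributed M lborel \<theta> (\<lambda>x. ennreal (std_cov_normal_density \<theta>0 x)) \<and>
     prob_space.indep_set M
       (sets (vimage_algebra (space M) \<theta> borel))
       (sets (generated_sigma M {1..} w))"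

text \<open>A feedback law is a family of Borel functions of the observed outputs \<open>y\<^sub>0, \<dots>, y\<^sub>t\<close>.  It is
  chosen before, and hence does not depend on, the (deterministic) initial condition.\<close>

definition feedback_law :: "(nat \<Rightarrow> (nat \<Rightarrow> real) \<Rightarrow> real) \<Rightarrow> bool" where
  "feedback_law h \<longleftrightarrow> (\<forall>t. h t \<in> borel_measurable (Pi\<^sub>M {..t} (\<lambda>_. borel)))"

definition closed_loop ::
    "'a measure \<Rightarrow> (real \<Rightarrow> real ^ 'n) \<Rightarrow> ('a \<Rightarrow> real ^ 'n) \<Rightarrow> (nat \<Rightarrow> 'a \<Rightarrow> real) \<Rightarrow>
     (nat \<Rightarrow> (nat \<Rightarrow> real) \<Rightarrow> real) \<Rightarrow> real \<Rightarrow>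
     (nat \<Rightarrow> 'a \<Rightarrow> real) \<Rightarrow> (nat \<Rightarrow> 'a \<Rightarrow> real) \<Rightarrow> bool" where
  "closed_loop M \<phi> \<theta> w h y0 y u \<longleftrightarrow>
     (\<forall>\<omega>\<in>space M. y 0 \<omega> = y0 \<and>
        (\<forall>t. u t \<omega> = h t (\<lambda>i\<in>{..t}. y i \<omega>)) \<and>
        (\<forall>t. y (Suc t) \<omega> = \<theta> \<omega> \<bullet> \<phi> (y t \<omega>) + u t \<omega> + w (Suc t) \<omega>))"

text \<open>On \<open>space M\<close> the closed loop determines \<open>y\<close> and \<open>u\<close> uniquely, so the inner existential
  quantifier only names the trajectory.  The supremum is taken in the extended reals.\<close>

definition as_globally_stabilizable ::
    "'a measure \<Rightarrow> (real \<Rightarrow> real ^ 'n) \<Rightarrow> ('a \<Rightarrow> real ^ 'n) \<Rightarrow> (nat \<Rightarrow> 'a \<Rightarrow> real) \<Rightarrow> bool" where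
  "as_globally_stabilizable M \<phi> \<theta> w \<longleftrightarrow>
     (\<exists>h. feedback_law h \<and>
       (\<forall>y0. \<exists>y u. closed_loop M \<phi> \<theta> w h y0 y u \<and>
          (\<forall>t. u t \<in> borel_measurable (generated_sigma M {..t} y)) \<and>
          (AE \<omega> in M. (SUP t\<in>{1..}. ereal ((1 / real t) * (\<Sum>i=1..t. (y i \<omega>)\<^sup>2))) < \<infinity>)))"

end

theory Submission
  imports Defs "HOL-Real_Asymp.Real_Asymp"
begin

text \<open>
  First treat the parameter as unknown but fixed, and allow
  the controller an auxiliary i.i.d. Gaussian dither \<open>\<xi>\<close>, independent of everything else; there is
  a law that stabilizes the system for every \<open>\<theta>\<close>, almost surely in dither and noise.
  By Fubini's theorem some fixed sequence \<open>\<xi>\<close> then works for almost every \<open>(\<theta>, w)\<close>, and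
  freezing it leaves an admissible feedback law.

  Time is divided into the epochs \<open>[32 ^ k, 32 ^ Suc k)\<close>. Where \<open>\<phi>\<close> exceeds a threshold, the law
  applies the dither at a scale dominating \<open>\<theta> \<bullet> \<phi> y\<close>; since the set where
  \<open>norm (\<phi> x) \<le> L\<close> has positive lower density, the output falls into it with a probability
  bounded below. Below the threshold the current estimate is used for cancellation. By linear
  independence, finitely many open sets (bins) contain enough values of \<open>\<phi>\<close> to identify \<open>\<theta>\<close>
  from the averages of \<open>y (Suc t) - u t\<close> over the visits of each bin, with an error of order
  \<open>2 ^ - k\<close> after epoch \<open>k\<close>. As \<open>\<bar>w t\<bar>\<close> is eventually below any multiple of \<open>k\<close> in epoch \<open>k\<close>,
  the exponential growth bound keeps \<open>norm (\<phi> (y t))\<close> below \<open>L * 2 ^ k\<close>. So the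
  cancellation error stays bounded and the loop never leaves the good regime once it has entered it.
\<close>

text \<open>Two circularities shape the proof. Enough visits to the bins are guaranteed only under
  an accurate estimate, while an estimate is trusted only after enough visits. Acceptance is
  therefore tested on the data: an epoch with too few visits yields no estimate, and the smaller
  \<open>radius\<close> then keeps error times radius bounded anyway. So accuracy follows from the
  noise bounds alone, and the visits follow from accuracy. Second, estimates, visits and outputs all
  depend on past dither and noise, so no limit theorem for independent variables applies. Instead,
  exponential functionals of the trajectory are bounded geometrically, integrating out one current
  pair of dither and noise at a time; the code in force is fixed before its epoch and belongs to the
  past. Borel-Cantelli then leaves a deterministic argument. The dither answers a third difficulty:
  where \<phi> is large, ignorance of \<theta> makes the next output uncontrollable, and the set of
  small \<phi> may have long gaps. Only its density is known, so a random jump whose scale dominates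
  the unknown drift is what hits it with uniformly positive probability.\<close>

section \<open>Gaussian sequences\<close>

text \<open>This replaces conditioning on the past. \<open>comb_seq t\<close> writes an i.i.d.
  sequence as its first \<open>t\<close> entries followed by an independent fresh sequence; entry 0
  of the latter sits at position \<open>t\<close> and is not seen by \<open>g\<close> through its
  first argument.\<close>

lemma (in sequence_space) nn_integral_past:
  assumes g [measurable]: "(\<lambda>(\<omega>, z). g \<omega> z) \<in> borel_measurable (S \<Otimes>\<^sub>M M)"
    and past: "\<And>\<omega> \<omega>' z. (\<And>i. i < t \<Longrightarrow> \<omega> i = \<omega>' i) \<Longrightarrow> g \<omega> z = g \<omega>' z"
  shows "(\<integral>\<^sup>+\<omega>. g \<omega> (\<omega> t) \<partial>S) = (\<integral>\<^sup>+\<omega>. (\<integral>\<^sup>+z. g \<omega> z \<partial>M) \<partial>S)"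
proof -
  have "(\<integral>\<^sup>+\<omega>. g \<omega> (\<omega> t) \<partial>S) =
      (\<integral>\<^sup>+\<omega>. g \<omega> (\<omega> t) \<partial>distr (S \<Otimes>\<^sub>M S) S (\<lambda>(\<omega>, \<omega>'). comb_seq t \<omega> \<omega>'))"
    by (simp add: PiM_comb_seq)
  also have "\<dots> = (\<integral>\<^sup>+p. g (comb_seq t (fst p) (snd p)) (comb_seq t (fst p) (snd p) t) \<partial>(S \<Otimes>\<^sub>M S))"
    by (subst nn_integral_distr) (auto simp: case_prod_beta')
  also have "\<dots> = (\<integral>\<^sup>+p. g (fst p) (snd p 0) \<partial>(S \<Otimes>\<^sub>M S))"
  proof (rule nn_integral_cong)
    fix p :: "(nat \<Rightarrow> 'a) \<times> (nat \<Rightarrow> 'a)"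
    have "g (comb_seq t (fst p) (snd p)) z = g (fst p) z" for z
      by (rule past) (simp add: comb_seq_def)
    then show "g (comb_seq t (fst p) (snd p)) (comb_seq t (fst p) (snd p) t) = g (fst p) (snd p 0)"
      by (simp add: comb_seq_def)
  qed
  also have "\<dots> = (\<integral>\<^sup>+\<omega>. (\<integral>\<^sup>+\<omega>'. g \<omega> (\<omega>' 0) \<partial>S) \<partial>S)"
    by (subst P.nn_integral_fst[symmetric]) auto
  also have "\<dots> = (\<integral>\<^sup>+\<omega>. (\<integral>\<^sup>+z. g \<omega> z \<partial>M) \<partial>S)"
  proof (rule nn_integral_cong)
    fix \<omega> assume [measurable]: "\<omega> \<in> space S"
    have "(\<integral>\<^sup>+\<omega>'. g \<omega> (\<omega>' 0) \<partial>S) = (\<integral>\<^sup>+z. g \<omega> z \<partial>distr S M (\<lambda>\<omega>'. \<omega>' 0))"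
      by (subst nn_integral_distr) auto
    then show "(\<integral>\<^sup>+\<omega>'. g \<omega> (\<omega>' 0) \<partial>S) = (\<integral>\<^sup>+z. g \<omega> z \<partial>M)"
      by (simp add: PiM_component)
  qed
  finally show ?thesis .
qed

text \<open>The same for a pair of independent sequences, the dither and the noise: the noise
  coordinate is integrated out with the dither held fixed, then the dither coordinate, and Fubini
  restores the order.\<close>

lemma (in sequence_space) nn_integral_past2:
  assumes g [measurable]: "g \<in> borel_measurable ((S \<Otimes>\<^sub>M S) \<Otimes>\<^sub>M (M \<Otimes>\<^sub>M M))"
    and past: "\<And>\<xi> \<xi>' \<eta> \<eta>' z. (\<And>i. i < t \<Longrightarrow> \<xi> i = \<xi>' i) \<Longrightarrow> (\<And>i. i < t \<Longrightarrow> \<eta> i = \<eta>' i)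
      \<Longrightarrow> g ((\<xi>, \<eta>), z) = g ((\<xi>', \<eta>'), z)"
  shows "(\<integral>\<^sup>+p. g (p, (fst p t, snd p t)) \<partial>(S \<Otimes>\<^sub>M S)) =
    (\<integral>\<^sup>+p. (\<integral>\<^sup>+a. (\<integral>\<^sup>+b. g (p, (a, b)) \<partial>M) \<partial>M) \<partial>(S \<Otimes>\<^sub>M S))"
proof -
  interpret MS: pair_sigma_finite M S ..
  have "(\<integral>\<^sup>+p. g (p, (fst p t, snd p t)) \<partial>(S \<Otimes>\<^sub>M S)) =
      (\<integral>\<^sup>+\<xi>. (\<integral>\<^sup>+\<eta>. g ((\<xi>, \<eta>), (\<xi> t, \<eta> t)) \<partial>S) \<partial>S)"
    by (subst P.nn_integral_fst[symmetric]) auto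
  also have "\<dots> = (\<integral>\<^sup>+\<xi>. (\<integral>\<^sup>+\<eta>. (\<integral>\<^sup>+b. g ((\<xi>, \<eta>), (\<xi> t, b)) \<partial>M) \<partial>S) \<partial>S)"
  proof (rule nn_integral_cong)
    fix \<xi> assume [measurable]: "\<xi> \<in> space S"
    have "\<xi> t \<in> space M" using \<open>\<xi> \<in> space S\<close> by (auto simp: space_PiM)
    note [measurable] = this
    show "(\<integral>\<^sup>+\<eta>. g ((\<xi>, \<eta>), (\<xi> t, \<eta> t)) \<partial>S) = (\<integral>\<^sup>+\<eta>. (\<integral>\<^sup>+b. g ((\<xi>, \<eta>), (\<xi> t, b)) \<partial>M) \<partial>S)"
      by (rule nn_integral_past) (measurable, auto intro!: past)
  qed
  also have "\<dots> = (\<integral>\<^sup>+\<xi>. (\<integral>\<^sup>+a. (\<integral>\<^sup>+\<eta>. (\<integral>\<^sup>+b. g ((\<xi>, \<eta>), (a, b)) \<partial>M) \<partial>S) \<partial>M) \<partial>S)"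
  proof (rule nn_integral_past)
    fix \<omega> \<omega>' :: "nat \<Rightarrow> 'a" and z assume "\<And>i. i < t \<Longrightarrow> \<omega> i = \<omega>' i"
    then have "g ((\<omega>, \<eta>), (z, b)) = g ((\<omega>', \<eta>), (z, b))" for \<eta> b by (intro past) auto
    then show "(\<integral>\<^sup>+\<eta>. (\<integral>\<^sup>+b. g ((\<omega>, \<eta>), (z, b)) \<partial>M) \<partial>S) = (\<integral>\<^sup>+\<eta>. (\<integral>\<^sup>+b. g ((\<omega>', \<eta>), (z, b)) \<partial>M) \<partial>S)"
      by simp
  qed measurable
  also have "\<dots> = (\<integral>\<^sup>+\<xi>. (\<integral>\<^sup>+\<eta>. (\<integral>\<^sup>+a. (\<integral>\<^sup>+b. g ((\<xi>, \<eta>), (a, b)) \<partial>M) \<partial>M) \<partial>S) \<partial>S)"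
  proof (rule nn_integral_cong)
    fix \<xi> assume [measurable]: "\<xi> \<in> space S"
    show "(\<integral>\<^sup>+a. (\<integral>\<^sup>+\<eta>. (\<integral>\<^sup>+b. g ((\<xi>, \<eta>), (a, b)) \<partial>M) \<partial>S) \<partial>M) =
        (\<integral>\<^sup>+\<eta>. (\<integral>\<^sup>+a. (\<integral>\<^sup>+b. g ((\<xi>, \<eta>), (a, b)) \<partial>M) \<partial>M) \<partial>S)"
      by (rule MS.Fubini'[symmetric]) measurable
  qed
  also have "\<dots> = (\<integral>\<^sup>+p. (\<integral>\<^sup>+a. (\<integral>\<^sup>+b. g (p, (a, b)) \<partial>M) \<partial>M) \<partial>(S \<Otimes>\<^sub>M S))"
    by (subst P.nn_integral_fst[symmetric]) auto
  finally show ?thesis .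
qed

section \<open>Gaussian integrals on the line\<close>

definition gauss :: "real \<Rightarrow> real measure" where
  "gauss \<sigma> = density lborel (\<lambda>x. ennreal (normal_density 0 \<sigma> x))"

lemma sets_gauss [simp, measurable_cong]: "sets (gauss \<sigma>) = sets borel"
  by (simp add: gauss_def)

lemma space_gauss [simp]: "space (gauss \<sigma>) = UNIV"
  by (simp add: gauss_def)

lemma prob_space_gauss: "\<sigma> > 0 \<Longrightarrow> prob_space (gauss \<sigma>)"
  unfolding gauss_def by (rule prob_space_normal_density)

lemma nn_integral_gauss:
  assumes [measurable]: "f \<in> borel_measurable borel"
  shows "(\<integral>\<^sup>+x. f x \<partial>gauss \<sigma>) = (\<integral>\<^sup>+x. ennreal (normal_density 0 \<sigma> x) * f x \<partial>lborel)"
  unfolding gauss_def by (rule nn_integral_density) auto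

lemma nn_integral_normal_density:
  assumes "\<sigma> > 0"
  shows "(\<integral>\<^sup>+x. ennreal (normal_density m \<sigma> x) \<partial>lborel) = 1"
  using assms by (subst nn_integral_eq_integral) auto

text \<open>Completing the square turns the tilted density into a multiple of a normal density with
  mean \<open>l * \<sigma>\<^sup>2\<close>.\<close>

lemma gauss_exp_linear:
  assumes "\<sigma> > 0"
  shows "(\<integral>\<^sup>+x. ennreal (exp (l * x)) \<partial>gauss \<sigma>) = ennreal (exp (l\<^sup>2 * \<sigma>\<^sup>2 / 2))"
proof -
  have *: "normal_density 0 \<sigma> x * exp (l * x) = exp (l\<^sup>2 * \<sigma>\<^sup>2 / 2) * normal_density (l * \<sigma>\<^sup>2) \<sigma> x" for x
  proof -
    have "- x\<^sup>2 / (2 * \<sigma>\<^sup>2) + l * x = l\<^sup>2 * \<sigma>\<^sup>2 / 2 + - (x - l * \<sigma>\<^sup>2)\<^sup>2 / (2 * \<sigma>\<^sup>2)"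
      using assms by (simp add: field_simps power2_eq_square)
    then have "exp (- x\<^sup>2 / (2 * \<sigma>\<^sup>2)) * exp (l * x) =
        exp (l\<^sup>2 * \<sigma>\<^sup>2 / 2) * exp (- (x - l * \<sigma>\<^sup>2)\<^sup>2 / (2 * \<sigma>\<^sup>2))"
      by (simp only: exp_add[symmetric])
    then show ?thesis by (simp add: normal_density_def)
  qed
  have "(\<integral>\<^sup>+x. ennreal (exp (l * x)) \<partial>gauss \<sigma>) =
     (\<integral>\<^sup>+x. ennreal (exp (l\<^sup>2 * \<sigma>\<^sup>2 / 2)) * ennreal (normal_density (l * \<sigma>\<^sup>2) \<sigma> x) \<partial>lborel)"
    by (subst nn_integral_gauss) (auto simp flip: ennreal_mult simp: *)
  also have "\<dots> = ennreal (exp (l\<^sup>2 * \<sigma>\<^sup>2 / 2))"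
    using assms by (subst nn_integral_cmult) (auto simp: nn_integral_normal_density)
  finally show ?thesis .
qed

text \<open>The exponent is half the critical rate, so the product is again Gaussian, with variance
  doubled and mass \<open>sqrt 2\<close>.\<close>

lemma gauss_exp_square:
  assumes "\<sigma> > 0"
  shows "(\<integral>\<^sup>+x. ennreal (exp (x\<^sup>2 / (4 * \<sigma>\<^sup>2))) \<partial>gauss \<sigma>) = ennreal (sqrt 2)"
proof -
  have *: "normal_density 0 \<sigma> x * exp (x\<^sup>2 / (4 * \<sigma>\<^sup>2)) = sqrt 2 * normal_density 0 (sqrt 2 * \<sigma>) x" for x
  proof -
    have "- x\<^sup>2 / (2 * \<sigma>\<^sup>2) + x\<^sup>2 / (4 * \<sigma>\<^sup>2) = - x\<^sup>2 / (2 * (sqrt 2 * \<sigma>)\<^sup>2)"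
      using assms by (simp add: field_simps)
    then have "exp (- x\<^sup>2 / (2 * \<sigma>\<^sup>2)) * exp (x\<^sup>2 / (4 * \<sigma>\<^sup>2)) = exp (- x\<^sup>2 / (2 * (sqrt 2 * \<sigma>)\<^sup>2))"
      by (simp only: exp_add[symmetric])
    then show ?thesis
      using assms by (simp add: normal_density_def real_sqrt_mult field_simps)
  qed
  have "(\<integral>\<^sup>+x. ennreal (exp (x\<^sup>2 / (4 * \<sigma>\<^sup>2))) \<partial>gauss \<sigma>) =
     (\<integral>\<^sup>+x. ennreal (sqrt 2) * ennreal (normal_density 0 (sqrt 2 * \<sigma>) x) \<partial>lborel)"
    by (subst nn_integral_gauss) (auto simp flip: ennreal_mult simp: *)
  also have "\<dots> = ennreal (sqrt 2)"
    using assms by (subst nn_integral_cmult) (auto simp: nn_integral_normal_density)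
  finally show ?thesis .
qed

text \<open>The preimage of \<open>A\<close> under the affine map has Lebesgue measure that of
  \<open>A\<close> divided by \<open>R\<close>, and it lies in \<open>{-s..s}\<close>, where the
  density is at least its value at \<open>s\<close>. Used with \<open>R = 1\<close> for the noise
  and with large \<open>R\<close> for the dither.\<close>

lemma gauss_hits:
  assumes \<sigma>: "\<sigma> > 0" and R: "R > 0" and A [measurable]: "A \<in> sets borel"
    and A_sub: "A \<subseteq> {-r..r}" and m: "\<bar>m\<bar> + r \<le> s * R"
  shows "ennreal (exp (- s\<^sup>2 / (2 * \<sigma>\<^sup>2)) / (sqrt (2 * pi) * \<sigma> * R)) * emeasure lborel A
    \<le> emeasure (gauss \<sigma>) {x. m + R * x \<in> A}"
proof -
  define c where "c = exp (- s\<^sup>2 / (2 * \<sigma>\<^sup>2)) / (sqrt (2 * pi) * \<sigma>)"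
  have "c \<ge> 0" using \<sigma> by (simp add: c_def)
  define A' where "A' = {x. m + R * x \<in> A}"
  have [measurable]: "A' \<in> sets borel" unfolding A'_def by measurable
  have "emeasure lborel A = ennreal R * emeasure lborel A'"
  proof -
    have "lborel = density (distr lborel borel (\<lambda>x. m + R * x)) (\<lambda>_. ennreal R)"
      using lborel_real_affine[of R m] R by simp
    then have "emeasure lborel A = emeasure (density (distr lborel borel (\<lambda>x. m + R * x)) (\<lambda>_. ennreal R)) A"
      by simp
    also have "\<dots> = (\<integral>\<^sup>+x. ennreal R * indicator A x \<partial>distr lborel borel (\<lambda>x. m + R * x))"
      by (subst emeasure_density) auto
    also have "\<dots> = (\<integral>\<^sup>+x. ennreal R * indicator A (m + R * x) \<partial>lborel)"
      by (subst nn_integral_distr) auto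
    also have "\<dots> = ennreal R * (\<integral>\<^sup>+x. indicator A' x \<partial>lborel)"
      by (subst nn_integral_cmult[symmetric]) (auto simp: A'_def indicator_def intro!: nn_integral_cong)
    finally show ?thesis by simp
  qed
  then have "ennreal (c / R) * emeasure lborel A = ennreal c * emeasure lborel A'"
    using R \<open>c \<ge> 0\<close> by (simp add: mult.assoc[symmetric] ennreal_mult[symmetric])
  also have "\<dots> = (\<integral>\<^sup>+x. ennreal c * indicator A' x \<partial>lborel)"
    by (simp add: nn_integral_cmult)
  also have "\<dots> \<le> (\<integral>\<^sup>+x. ennreal (normal_density 0 \<sigma> x) * indicator A' x \<partial>lborel)"
  proof (rule nn_integral_mono)
    fix x
    show "ennreal c * indicator A' x \<le> ennreal (normal_density 0 \<sigma> x) * indicator A' x"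
    proof (cases "x \<in> A'")
      case True
      then have "m + R * x \<in> {-r..r}" using A_sub by (auto simp: A'_def)
      then have "\<bar>R * x\<bar> \<le> s * R" using m by auto
      then have "\<bar>x\<bar> \<le> s" using R by (simp add: abs_mult)
      then have "x\<^sup>2 \<le> s\<^sup>2" by (metis abs_ge_zero power2_abs power_mono)
      then have "- s\<^sup>2 / (2 * \<sigma>\<^sup>2) \<le> - x\<^sup>2 / (2 * \<sigma>\<^sup>2)"
        using \<sigma> by (intro divide_right_mono) auto
      then have "c \<le> normal_density 0 \<sigma> x"
        using \<sigma> by (simp add: c_def normal_density_def real_sqrt_mult divide_right_mono)
      then show ?thesis using True by (simp add: ennreal_leI)
    qed simp
  qed
  also have "\<dots> = emeasure (gauss \<sigma>) A'"
    unfolding gauss_def by (rule emeasure_density[symmetric]) auto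
  finally show ?thesis using R unfolding c_def A'_def by (simp add: mult.assoc)
qed

section \<open>The adaptive feedback law\<close>

text \<open>Compactness of the unit sphere: a unit vector \<open>v\<close> has some \<open>x\<close>
  with \<open>v \<bullet> \<phi> x\<close> nonzero, and by continuity sign and size persist near
  \<open>x\<close> and near \<open>v\<close>. A fixed sign on a whole bin is essential, since
  contributions of different visits then cannot cancel.\<close>

lemma informative_bins:
  fixes \<phi> :: "real \<Rightarrow> real ^ 'n"
  assumes "open E" and cont: "continuous_on E \<phi>" and indep: "components_lin_indep_on \<phi> E"
  obtains \<B> :: "real set set" and \<kappa> b r :: real
  where "finite \<B>" "\<kappa> > 0"
    and "\<And>B. B \<in> \<B> \<Longrightarrow> open B" "\<And>B. B \<in> \<B> \<Longrightarrow> B \<noteq> {}" "\<And>B. B \<in> \<B> \<Longrightarrow> B \<subseteq> {-r..r}"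
    and "\<And>B y. B \<in> \<B> \<Longrightarrow> y \<in> B \<Longrightarrow> norm (\<phi> y) \<le> b"
    and "\<And>v. \<exists>B\<in>\<B>. (\<forall>y\<in>B. v \<bullet> \<phi> y \<ge> \<kappa> * norm v) \<or> (\<forall>y\<in>B. v \<bullet> \<phi> y \<le> - \<kappa> * norm v)"
proof -
  define good :: "real ^ 'n \<Rightarrow> real set \<Rightarrow> real \<Rightarrow> real \<Rightarrow> bool" where
    "good v B k d \<longleftrightarrow> open B \<and> B \<noteq> {} \<and> bounded B \<and> bounded (\<phi> ` B) \<and> k > 0 \<and> d > 0 \<and>
      (\<forall>v'\<in>ball v d. norm v' = 1 \<longrightarrow> (\<forall>y\<in>B. v' \<bullet> \<phi> y \<ge> k) \<or> (\<forall>y\<in>B. v' \<bullet> \<phi> y \<le> - k))" for v B k d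
  have local: "\<exists>B k d. good v B k d" if v: "norm v = 1" for v
  proof -
    have "v \<noteq> 0" using v by auto
    then obtain x where x: "x \<in> E" "v \<bullet> \<phi> x \<noteq> 0"
      using indep unfolding components_lin_indep_on_def inner_vec_def by auto
    \<comment> \<open>The two perturbations cost at most \<open>s\<close> each, so of the
      \<open>4 * s\<close> at \<open>x\<close> more than \<open>s\<close> survives.\<close>
    define s where "s = \<bar>v \<bullet> \<phi> x\<bar> / 4"
    have "s > 0" using x by (simp add: s_def)
    have "isCont \<phi> x"
      using cont x \<open>open E\<close> by (simp add: continuous_on_eq_continuous_at)
    then obtain d1 where d1: "d1 > 0" "\<And>y. dist y x < d1 \<Longrightarrow> dist (\<phi> y) (\<phi> x) < s"
      using \<open>s > 0\<close> unfolding continuous_at_eps_delta by blast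
    define d2 where "d2 = s / (1 + norm (\<phi> x))"
    have "d2 > 0" using \<open>s > 0\<close> unfolding d2_def by (intro divide_pos_pos) (auto intro: add_pos_nonneg)
    have close: "\<bar>v' \<bullet> \<phi> y - v \<bullet> \<phi> x\<bar> \<le> 2 * s"
      if "v' \<in> ball v d2" "norm v' = 1" "y \<in> ball x d1" for v' y
    proof -
      have "v' \<bullet> \<phi> y - v \<bullet> \<phi> x = v' \<bullet> (\<phi> y - \<phi> x) + (v' - v) \<bullet> \<phi> x"
        by (simp add: inner_diff_left inner_diff_right)
      moreover have "\<bar>v' \<bullet> (\<phi> y - \<phi> x)\<bar> \<le> s"
      proof -
        have "norm (\<phi> y - \<phi> x) < s"
          using d1(2)[of y] that(3) by (simp add: dist_commute) (simp add: dist_norm norm_minus_commute)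
        then show ?thesis using Cauchy_Schwarz_ineq2[of v' "\<phi> y - \<phi> x"] that(2) by simp
      qed
      moreover have "\<bar>(v' - v) \<bullet> \<phi> x\<bar> \<le> s"
      proof -
        have "\<bar>(v' - v) \<bullet> \<phi> x\<bar> \<le> norm (v' - v) * norm (\<phi> x)" by (rule Cauchy_Schwarz_ineq2)
        also have "\<dots> \<le> d2 * (1 + norm (\<phi> x))"
          using that \<open>d2 > 0\<close> by (intro mult_mono) (auto simp: dist_norm norm_minus_commute)
        also have "\<dots> = s" unfolding d2_def by (smt (verit) norm_ge_zero nonzero_eq_divide_eq)
        finally show ?thesis .
      qed
      ultimately show ?thesis by linarith
    qed
    have "bounded (\<phi> ` ball x d1)"
    proof (rule boundedI)
      fix z assume "z \<in> \<phi> ` ball x d1"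
      then obtain y where y: "z = \<phi> y" "dist y x < d1" by (auto simp: dist_commute)
      show "norm z \<le> norm (\<phi> x) + s"
        using d1(2)[OF y(2)] norm_triangle_sub[of "\<phi> y" "\<phi> x"] y(1) by (simp add: dist_norm)
    qed
    moreover have "(\<forall>y\<in>ball x d1. v' \<bullet> \<phi> y \<ge> s) \<or> (\<forall>y\<in>ball x d1. v' \<bullet> \<phi> y \<le> - s)"
      if "v' \<in> ball v d2" "norm v' = 1" for v'
    proof (cases "v \<bullet> \<phi> x > 0")
      case True
      then have "v \<bullet> \<phi> x = 4 * s" by (simp add: s_def)
      then show ?thesis using close[OF that] \<open>s > 0\<close> by (intro disjI1 ballI) (smt (verit))
    next
      case False
      then have "v \<bullet> \<phi> x = - 4 * s" by (simp add: s_def)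
      then show ?thesis using close[OF that] \<open>s > 0\<close> by (intro disjI2 ballI) (smt (verit))
    qed
    ultimately have "good v (ball x d1) s d2"
      unfolding good_def using d1(1) \<open>s > 0\<close> \<open>d2 > 0\<close> by auto
    then show ?thesis by blast
  qed
  then obtain B k d where g: "\<And>v. norm v = 1 \<Longrightarrow> good v (B v) (k v) (d v)" by metis
  have "compact (sphere 0 1 :: (real ^ 'n) set)" by simp
  then obtain C where C: "C \<subseteq> sphere 0 1" "finite C" "sphere 0 1 \<subseteq> (\<Union>v\<in>C. ball v (d v))"
  proof (rule compactE_image)
    show "sphere 0 1 \<subseteq> (\<Union>v\<in>sphere 0 1. ball v (d v))"
      using g unfolding good_def by force
  qed auto
  define \<kappa> where "\<kappa> = Min (insert 1 (k ` C))"
  have gC: "good v (B v) (k v) (d v)" if "v \<in> C" for v using g C that by auto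
  have "\<kappa> > 0" unfolding \<kappa>_def using C gC by (auto simp: good_def)
  have \<kappa>_le: "\<kappa> \<le> k v" if "v \<in> C" for v using C that by (auto simp: \<kappa>_def)
  have unit: "\<exists>B'\<in>B ` C. (\<forall>y\<in>B'. v \<bullet> \<phi> y \<ge> \<kappa>) \<or> (\<forall>y\<in>B'. v \<bullet> \<phi> y \<le> - \<kappa>)" if "norm v = 1" for v
  proof -
    have "v \<in> sphere 0 1" using that by simp
    then obtain c where c: "c \<in> C" "v \<in> ball c (d c)" using C(3) by blast
    then have "(\<forall>y\<in>B c. v \<bullet> \<phi> y \<ge> k c) \<or> (\<forall>y\<in>B c. v \<bullet> \<phi> y \<le> - k c)"
      using gC[OF c(1)] that unfolding good_def by blast
    then show ?thesis using c(1) \<kappa>_le[OF c(1)] by fastforce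
  qed
  have all: "\<exists>B'\<in>B ` C. (\<forall>y\<in>B'. v \<bullet> \<phi> y \<ge> \<kappa> * norm v) \<or> (\<forall>y\<in>B'. v \<bullet> \<phi> y \<le> - \<kappa> * norm v)" for v
  proof (cases "v = 0")
    case True
    \<comment> \<open>The zero vector only asks that some bin exist; any unit vector supplies
      one.\<close>
    have "norm (axis undefined 1 :: real ^ 'n) = 1" by simp
    from unit[OF this] show ?thesis using True by auto
  next
    case False
    then have eq: "v \<bullet> y = norm v * ((v /\<^sub>R norm v) \<bullet> y)" for y by simp
    have "norm (v /\<^sub>R norm v) = 1" using False by simp
    from unit[OF this] obtain B' where B': "B' \<in> B ` C"
      "(\<forall>y\<in>B'. (v /\<^sub>R norm v) \<bullet> \<phi> y \<ge> \<kappa>) \<or> (\<forall>y\<in>B'. (v /\<^sub>R norm v) \<bullet> \<phi> y \<le> - \<kappa>)" by blast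
    show ?thesis
    proof (rule bexI[OF _ B'(1)], use B'(2) in \<open>elim disj_forward\<close>; intro ballI)
      fix y assume "\<forall>y\<in>B'. (v /\<^sub>R norm v) \<bullet> \<phi> y \<ge> \<kappa>" "y \<in> B'"
      then have "norm v * \<kappa> \<le> norm v * ((v /\<^sub>R norm v) \<bullet> \<phi> y)" by (intro mult_left_mono) auto
      then show "\<kappa> * norm v \<le> v \<bullet> \<phi> y" unfolding eq[of "\<phi> y", symmetric] by (simp add: mult.commute)
    next
      fix y assume "\<forall>y\<in>B'. (v /\<^sub>R norm v) \<bullet> \<phi> y \<le> - \<kappa>" "y \<in> B'"
      then have "norm v * ((v /\<^sub>R norm v) \<bullet> \<phi> y) \<le> norm v * (- \<kappa>)" by (intro mult_left_mono) auto
      then show "v \<bullet> \<phi> y \<le> - \<kappa> * norm v" unfolding eq[of "\<phi> y", symmetric] by (simp add: mult.commute)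
    qed
  qed
  have "bounded (\<Union>v\<in>C. B v)" "bounded (\<Union>v\<in>C. \<phi> ` B v)"
    using C(2) gC by (auto simp: good_def)
  then obtain r b where "\<forall>y\<in>(\<Union>v\<in>C. B v). norm y \<le> r" "\<forall>y\<in>(\<Union>v\<in>C. \<phi> ` B v). norm y \<le> b"
    unfolding bounded_iff by (elim exE)
  then have r: "\<And>y. y \<in> (\<Union>v\<in>C. B v) \<Longrightarrow> norm y \<le> r"
    and b: "\<And>y. y \<in> (\<Union>v\<in>C. \<phi> ` B v) \<Longrightarrow> norm y \<le> b" by (blast dest: bspec)+
  show ?thesis
  proof (rule that[of "B ` C" \<kappa> r b])
    show "B' \<subseteq> {-r..r}" if "B' \<in> B ` C" for B'
      using that r by (force simp: abs_le_iff)
    show "norm (\<phi> y) \<le> b" if "B' \<in> B ` C" "y \<in> B'" for B' y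
      using that b by auto
  qed (use C(2) \<open>\<kappa> > 0\<close> gC all in \<open>auto simp: good_def\<close>)
qed

section \<open>The time scale\<close>

definition epoch :: "nat \<Rightarrow> nat" where
  "epoch t = (LEAST k. t < 32 ^ Suc k)"

definition window :: "nat \<Rightarrow> nat set" where
  "window k = {32 ^ k..<32 ^ Suc k}"

lemma finite_window [simp]: "finite (window k)"
  by (simp add: window_def)

lemma card_window: "card (window k) = 31 * 32 ^ k"
  by (simp add: window_def)

lemma less_32_power: "t < 32 ^ Suc t" for t :: nat
  by (induction t) auto

lemma epoch_window:
  assumes "t \<in> window k" shows "epoch t = k"
  unfolding epoch_def
proof (rule Least_equality)
  fix j assume "t < 32 ^ Suc j"
  with assms have "(32::nat) ^ k < 32 ^ Suc j" by (auto simp: window_def)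
  then show "k \<le> j" by (simp add: power_strict_increasing_iff del: power_Suc)
qed (use assms in \<open>simp add: window_def\<close>)

lemma window_epoch:
  assumes "t \<ge> 1" shows "t \<in> window (epoch t)"
proof -
  \<comment> \<open>Time 0 is excluded by the assumption: it has epoch 0 but lies in no
    window.\<close>
  have "t < 32 ^ Suc (epoch t)"
    unfolding epoch_def by (rule LeastI[of _ t]) (rule less_32_power)
  moreover have "32 ^ epoch t \<le> t"
  proof (cases "epoch t")
    case (Suc j)
    then have "j < epoch t" by simp
    then have "\<not> t < 32 ^ Suc j" unfolding epoch_def by (rule not_less_Least)
    then show ?thesis using Suc by simp
  qed (use assms in simp)
  ultimately show ?thesis by (simp add: window_def)
qed

abbreviation real_seq :: "(nat \<Rightarrow> real) measure" where
  "real_seq \<equiv> Pi\<^sub>M UNIV (\<lambda>_. borel)"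

lemma measurable_real_seqI:
  assumes "\<And>i. (\<lambda>x. f x i) \<in> borel_measurable M"
  shows "f \<in> measurable M real_seq"
  by (rule measurable_PiM_single') (use assms in auto)

text \<open>Only the data on which the law depends are fixed here. The parameter, the noise level
  and the constants of the hypotheses enter with \<open>adaptive_loop\<close>, so that one law
  serves every \<theta>.\<close>

locale adaptive_law =
  fixes \<phi> :: "real \<Rightarrow> real ^ 'n" and L :: real and \<B> :: "real set set" and D :: "nat \<Rightarrow> real ^ 'n"
  assumes \<phi>_measurable [measurable]: "\<phi> \<in> borel_measurable borel"
    and finite_bins: "finite \<B>"
    and borel_bins: "\<And>B. B \<in> \<B> \<Longrightarrow> B \<in> sets borel"
begin

text \<open>The estimate is encoded by a natural number: \<open>0\<close> means that there is none (yet), and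
  \<open>Suc m\<close> stands for the vector \<open>D m\<close>.\<close>

definition estimate :: "nat \<Rightarrow> real ^ 'n" where
  "estimate e = (case e of 0 \<Rightarrow> 0 | Suc m \<Rightarrow> D m)"

text \<open>Chosen so that estimation error times radius stays bounded: without an estimate the
  error is \<open>norm \<theta>\<close>, which does not shrink, and the radius must not
  grow.\<close>

definition radius :: "nat \<Rightarrow> nat \<Rightarrow> real" where
  "radius k e = (if e = 0 then L else L * 2 ^ k)"

text \<open>Certainty equivalence where \<open>\<phi>\<close> is moderate; elsewhere a dither whose scale eventually exceeds
  \<open>\<bar>\<theta> \<bullet> \<phi> y\<bar>\<close>, because \<open>k\<close> grows beyond \<open>norm \<theta>\<close>.\<close>

definition control :: "nat \<Rightarrow> nat \<Rightarrow> real \<Rightarrow> real \<Rightarrow> real" where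
  "control k e \<xi> y = (if norm (\<phi> y) \<le> radius k e then - (estimate e \<bullet> \<phi> y)
    else real k * (1 + norm (\<phi> y)) * \<xi>)"

definition visits :: "nat \<Rightarrow> real set \<Rightarrow> (nat \<Rightarrow> real) \<Rightarrow> real" where
  "visits k B y = (\<Sum>t\<in>window k. indicator B (y t))"

text \<open>Subtracting the applied input from the next output leaves
  \<open>\<theta> \<bullet> \<phi> (y t)\<close> plus noise, so the candidate \<open>D m\<close> is
  tested on observable data. The input is recomputed from the dither rather than recorded.\<close>

definition residual :: "nat \<Rightarrow> nat \<Rightarrow> nat \<Rightarrow> real set \<Rightarrow> (nat \<Rightarrow> real) \<Rightarrow> (nat \<Rightarrow> real) \<Rightarrow> real" where
  "residual k e m B \<xi> y =
    (\<Sum>t\<in>window k. indicator B (y t) * (y (Suc t) - control k e (\<xi> t) (y t) - D m \<bullet> \<phi> (y t)))"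

text \<open>In an epoch of length about \<open>32 ^ k\<close> the noise sums are at most \<open>8 ^ k\<close> (more than the square
  root of the length) and the bins are visited at least \<open>16 ^ k\<close> times (less than the length); the
  quotient \<open>2 ^ k\<close> of the two is the precision of the estimate, hence the growth of \<open>radius\<close>.\<close>

definition accept :: "nat \<Rightarrow> nat \<Rightarrow> nat \<Rightarrow> (nat \<Rightarrow> real) \<Rightarrow> (nat \<Rightarrow> real) \<Rightarrow> bool" where
  "accept k e m \<xi> y \<longleftrightarrow> (\<forall>B\<in>\<B>. 16 ^ k \<le> visits k B y \<and> \<bar>residual k e m B \<xi> y\<bar> \<le> 2 * 8 ^ k)"

text \<open>Taking the first acceptable member of a countable list keeps the selection measurable.
  Each epoch starts afresh: the previous code enters only to reconstruct the inputs, and a failed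
  test discards the old estimate.\<close>

fun est :: "nat \<Rightarrow> (nat \<Rightarrow> real) \<Rightarrow> (nat \<Rightarrow> real) \<Rightarrow> nat" where
  "est 0 \<xi> y = 0"
| "est (Suc k) \<xi> y = (if \<exists>m. accept k (est k \<xi> y) m \<xi> y
    then Suc (LEAST m. accept k (est k \<xi> y) m \<xi> y) else 0)"

definition law :: "(nat \<Rightarrow> real) \<Rightarrow> nat \<Rightarrow> (nat \<Rightarrow> real) \<Rightarrow> real" where
  "law \<xi> t y = (if t = 0 then 0 else control (epoch t) (est (epoch t) \<xi> y) (\<xi> t) (y t))"

text \<open>The law reads the whole past, so the recursion runs over histories; entries beyond the
  current time are never read. Here \<open>\<eta> t\<close> is the noise that acts on the output at
  time \<open>Suc t\<close>.\<close>

primrec hist :: "real ^ 'n \<Rightarrow> real \<Rightarrow> (nat \<Rightarrow> real) \<Rightarrow> (nat \<Rightarrow> real) \<Rightarrow> nat \<Rightarrow> nat \<Rightarrow> real" where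
  "hist \<theta> y0 \<xi> \<eta> 0 = (\<lambda>_. y0)"
| "hist \<theta> y0 \<xi> \<eta> (Suc t) = (hist \<theta> y0 \<xi> \<eta> t)
    (Suc t := \<theta> \<bullet> \<phi> (hist \<theta> y0 \<xi> \<eta> t t) + law \<xi> t (hist \<theta> y0 \<xi> \<eta> t) + \<eta> t)"

definition traj :: "real ^ 'n \<Rightarrow> real \<Rightarrow> (nat \<Rightarrow> real) \<Rightarrow> (nat \<Rightarrow> real) \<Rightarrow> nat \<Rightarrow> real" where
  "traj \<theta> y0 \<xi> \<eta> t = hist \<theta> y0 \<xi> \<eta> t t"

section \<open>Causality of the law and of the trajectory\<close>

lemma residual_cong:
  assumes "\<And>i. 1 \<le> i \<Longrightarrow> i \<le> 32 ^ Suc k \<Longrightarrow> y i = y' i" "\<And>i. i < 32 ^ Suc k \<Longrightarrow> \<xi> i = \<xi>' i"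
  shows "residual k e m B \<xi> y = residual k e m B \<xi>' y'"
  unfolding residual_def
proof (rule sum.cong[OF refl])
  fix t assume "t \<in> window k"
  then have "1 \<le> t" "t < 32 ^ Suc k"
    using one_le_power[of "32::nat" k] by (auto simp: window_def)
  then show "indicator B (y t) * (y (Suc t) - control k e (\<xi> t) (y t) - D m \<bullet> \<phi> (y t)) =
      indicator B (y' t) * (y' (Suc t) - control k e (\<xi>' t) (y' t) - D m \<bullet> \<phi> (y' t))"
    using assms(1)[of t] assms(1)[of "Suc t"] assms(2)[of t] by (simp del: power_Suc)
qed

lemma visits_cong:
  assumes "\<And>i. 1 \<le> i \<Longrightarrow> i \<le> 32 ^ Suc k \<Longrightarrow> y i = y' i"
  shows "visits k B y = visits k B y'"
  unfolding visits_def
proof (rule sum.cong[OF refl])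
  fix t assume "t \<in> window k"
  then have "1 \<le> t" "t < 32 ^ Suc k"
    using one_le_power[of "32::nat" k] by (auto simp: window_def)
  then show "indicator B (y t) = indicator B (y' t)"
    using assms(1)[of t] by (simp del: power_Suc)
qed

text \<open>The bound on the outputs is inclusive because the last residual before epoch
  \<open>k\<close> reads the output at time \<open>32 ^ k\<close>. This is the very time at which
  epoch \<open>k\<close> begins, so the code is available when first used.\<close>

lemma est_cong:
  assumes "\<And>i. 1 \<le> i \<Longrightarrow> i \<le> 32 ^ k \<Longrightarrow> y i = y' i" "\<And>i. i < 32 ^ k \<Longrightarrow> \<xi> i = \<xi>' i"
  shows "est k \<xi> y = est k \<xi>' y'"
  using assms
proof (induction k)
  case (Suc k)
  have "est k \<xi> y = est k \<xi>' y'" by (rule Suc.IH) (use Suc.prems in auto)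
  moreover have "accept k e m \<xi> y = accept k e m \<xi>' y'" for e m
    unfolding accept_def
    using residual_cong[of k y y' \<xi> \<xi>'] visits_cong[of k y y'] Suc.prems by metis
  ultimately show ?case by simp
qed simp

lemma law_cong:
  assumes "\<And>i. 1 \<le> i \<Longrightarrow> i \<le> t \<Longrightarrow> y i = y' i" "\<And>i. i \<le> t \<Longrightarrow> \<xi> i = \<xi>' i"
  shows "law \<xi> t y = law \<xi>' t y'"
proof (cases "t = 0")
  case False
  then have "32 ^ epoch t \<le> t" using window_epoch[of t] by (simp add: window_def)
  then have "est (epoch t) \<xi> y = est (epoch t) \<xi>' y'"
    by (intro est_cong) (use assms in auto)
  then show ?thesis using assms(1)[of t] assms(2)[of t] False by (simp add: law_def)
qed (simp add: law_def)

lemma hist_eq: "i \<le> t \<Longrightarrow> hist \<theta> y0 \<xi> \<eta> t i = traj \<theta> y0 \<xi> \<eta> i"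
  by (induction t) (auto simp: traj_def le_Suc_eq)

lemma traj_0 [simp]: "traj \<theta> y0 \<xi> \<eta> 0 = y0"
  by (simp add: traj_def)

lemma traj_Suc:
  "traj \<theta> y0 \<xi> \<eta> (Suc t) =
    \<theta> \<bullet> \<phi> (traj \<theta> y0 \<xi> \<eta> t) + law \<xi> t (traj \<theta> y0 \<xi> \<eta>) + \<eta> t"
proof -
  have "law \<xi> t (hist \<theta> y0 \<xi> \<eta> t) = law \<xi> t (traj \<theta> y0 \<xi> \<eta>)"
    by (rule law_cong) (simp_all add: hist_eq)
  then show ?thesis by (simp add: traj_def)
qed

lemma traj_Suc_window:
  assumes "t \<in> window k"
  shows "traj \<theta> y0 \<xi> \<eta> (Suc t) = \<theta> \<bullet> \<phi> (traj \<theta> y0 \<xi> \<eta> t)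
    + control k (est k \<xi> (traj \<theta> y0 \<xi> \<eta>)) (\<xi> t) (traj \<theta> y0 \<xi> \<eta> t) + \<eta> t"
proof -
  have "t > 0" using assms one_le_power[of "32::nat" k] by (auto simp: window_def)
  then show ?thesis using assms by (simp add: traj_Suc law_def epoch_window)
qed

text \<open>The output at time \<open>t\<close> is driven by noise and dither with indices below
  \<open>t\<close>. This is what allows the coordinates at \<open>t\<close> to be integrated out as
  independent of it.\<close>

lemma traj_past:
  assumes "\<And>i. i < t \<Longrightarrow> \<xi> i = \<xi>' i" "\<And>i. i < t \<Longrightarrow> \<eta> i = \<eta>' i" "s \<le> t"
  shows "traj \<theta> y0 \<xi> \<eta> s = traj \<theta> y0 \<xi>' \<eta>' s"
  using \<open>s \<le> t\<close>
proof (induction s rule: less_induct)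
  case (less s)
  show ?case
  proof (cases s)
    case (Suc j)
    have "law \<xi> j (traj \<theta> y0 \<xi> \<eta>) = law \<xi>' j (traj \<theta> y0 \<xi>' \<eta>')"
      by (rule law_cong) (use less Suc assms in auto)
    then show ?thesis using less.IH[of j] less.prems assms(2)[of j] Suc by (simp add: traj_Suc)
  qed simp
qed

text \<open>The code in force during \<open>window k\<close> is settled before any dither or noise
  of that window is drawn, so it acts as a constant when a one-step bound is iterated through the
  epoch.\<close>

lemma est_past:
  assumes "\<And>i. i < t \<Longrightarrow> \<xi> i = \<xi>' i" "\<And>i. i < t \<Longrightarrow> \<eta> i = \<eta>' i" "32 ^ k \<le> t"
  shows "est k \<xi> (traj \<theta> y0 \<xi> \<eta>) = est k \<xi>' (traj \<theta> y0 \<xi>' \<eta>')"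
proof (rule est_cong)
  fix i assume "i \<le> (32::nat) ^ k"
  then show "traj \<theta> y0 \<xi> \<eta> i = traj \<theta> y0 \<xi>' \<eta>' i"
    by (intro traj_past[of t]) (use assms in auto)
qed (use assms in auto)

text \<open>Since \<open>law\<close> ignores the output at time \<open>0\<close>, the initial value acts only through the output
  at time \<open>1\<close>, where it can be traded for the noise.\<close>

lemma traj_initial_shift:
  assumes "t \<ge> 1"
  shows "traj \<theta> y0 \<xi> \<eta> t = traj \<theta> y0' \<xi> (\<eta>(0 := \<eta> 0 + \<theta> \<bullet> \<phi> y0 - \<theta> \<bullet> \<phi> y0')) t"
  using assms
proof (induction t rule: less_induct)
  case (less t)
  then obtain j where j: "t = Suc j" by (cases t) auto
  show ?case
  proof (cases "j = 0")
    case False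
    let ?\<eta> = "\<eta>(0 := \<eta> 0 + \<theta> \<bullet> \<phi> y0 - \<theta> \<bullet> \<phi> y0')"
    have "law \<xi> j (traj \<theta> y0 \<xi> \<eta>) = law \<xi> j (traj \<theta> y0' \<xi> ?\<eta>)"
    proof (rule law_cong)
      fix i assume "1 \<le> i" "i \<le> j"
      then show "traj \<theta> y0 \<xi> \<eta> i = traj \<theta> y0' \<xi> ?\<eta> i" by (intro less.IH) (use j in auto)
    qed simp
    moreover have "traj \<theta> y0 \<xi> \<eta> j = traj \<theta> y0' \<xi> ?\<eta> j"
      by (intro less.IH) (use j False in auto)
    moreover have "?\<eta> j = \<eta> j" using False by simp
    ultimately show ?thesis unfolding j traj_Suc by (simp only:)
  qed (simp add: j traj_Suc law_def)
qed

text \<open>Codes range over a countable set, so it suffices to treat each constant code. This is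
  the benefit of encoding estimates by numbers.\<close>

lemma measurable_control [measurable (raw)]:
  assumes [measurable]: "e \<in> measurable M (count_space UNIV)" "x \<in> borel_measurable M" "y \<in> borel_measurable M"
  shows "(\<lambda>\<omega>. control k (e \<omega>) (x \<omega>) (y \<omega>)) \<in> borel_measurable M"
proof (rule measurable_compose_countable[of "\<lambda>e \<omega>. control k e (x \<omega>) (y \<omega>)"])
  show "(\<lambda>\<omega>. control k i (x \<omega>) (y \<omega>)) \<in> borel_measurable M" for i
    unfolding control_def by measurable
qed simp

lemma measurable_visits [measurable]:
  assumes [measurable]: "B \<in> sets borel"
  shows "visits k B \<in> borel_measurable real_seq"
  unfolding visits_def[abs_def] by measurable

lemma measurable_est [measurable]:
  "(\<lambda>(\<xi>, y). est k \<xi> y) \<in> measurable (real_seq \<Otimes>\<^sub>M real_seq) (count_space UNIV)"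
proof (induction k)
  case 0
  then show ?case by simp
next
  case (Suc k)
  note [measurable] = Suc borel_bins
  have [measurable]: "Measurable.pred (real_seq \<Otimes>\<^sub>M real_seq) (\<lambda>p. accept k e m (fst p) (snd p))" for e m
    unfolding accept_def residual_def
    by (intro pred_intros_finite(3)[OF finite_bins] pred_intros_logic) measurable
  have [measurable]: "Measurable.pred (real_seq \<Otimes>\<^sub>M real_seq)
      (\<lambda>p. accept k (est k (fst p) (snd p)) m (fst p) (snd p))" for m
    by (rule measurable_compose_countable[of "\<lambda>e p. accept k e m (fst p) (snd p)"])
      (use Suc in \<open>simp_all add: case_prod_beta'\<close>)
  show ?case by (simp add: case_prod_beta') measurable
qed

lemma measurable_law [measurable]:
  "(\<lambda>(\<xi>, y). law \<xi> t y) \<in> borel_measurable (real_seq \<Otimes>\<^sub>M real_seq)"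
  unfolding law_def by measurable

lemma measurable_traj:
  "(\<lambda>(\<theta>, \<xi>, \<eta>). traj \<theta> y0 \<xi> \<eta> t) \<in> borel_measurable (borel \<Otimes>\<^sub>M (real_seq \<Otimes>\<^sub>M real_seq))"
proof -
  have hist: "(\<lambda>p. hist (fst p) y0 (fst (snd p)) (snd (snd p)) t i)
      \<in> borel_measurable (borel \<Otimes>\<^sub>M (real_seq \<Otimes>\<^sub>M real_seq))" for t i
  proof (induction t arbitrary: i)
    case (Suc t)
    note [measurable] = Suc
    have [measurable]: "(\<lambda>p. hist (fst p) y0 (fst (snd p)) (snd (snd p)) t)
        \<in> measurable (borel \<Otimes>\<^sub>M (real_seq \<Otimes>\<^sub>M real_seq)) real_seq"
      by (rule measurable_real_seqI) (rule Suc)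
    show ?case by (cases "i = Suc t") (simp_all add: case_prod_beta')
  qed simp
  show ?thesis using hist[of t t] by (simp add: traj_def case_prod_beta')
qed

end

section \<open>Pathwise analysis of the closed loop\<close>

text \<open>The parameter is now a constant. \<open>\<kappa>\<close>, \<open>b\<close> and
  \<open>r\<close> describe the bins; \<open>c\<close> and \<open>l0\<close> make the lower density
  of the set of small \<phi> quantitative.\<close>

locale adaptive_loop = adaptive_law \<phi> L \<B> D
  for \<phi> :: "real \<Rightarrow> real ^ 'n" and L \<B> D +
  fixes \<theta> :: "real ^ 'n" and y0 \<sigma> \<kappa> b r k1 k2 c l0 :: real
  assumes L_pos: "L > 0" and \<sigma>_pos: "\<sigma> > 0" and \<kappa>_pos: "\<kappa> > 0"
    and nonempty_bins: "\<And>B. B \<in> \<B> \<Longrightarrow> B \<noteq> {}"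
    and open_bins: "\<And>B. B \<in> \<B> \<Longrightarrow> open B"
    and bounded_bins: "\<And>B. B \<in> \<B> \<Longrightarrow> B \<subseteq> {-r..r}"
    and \<phi>_bins: "\<And>B y. B \<in> \<B> \<Longrightarrow> y \<in> B \<Longrightarrow> norm (\<phi> y) \<le> b"
    and informative: "\<And>v. \<exists>B\<in>\<B>. (\<forall>y\<in>B. v \<bullet> \<phi> y \<ge> \<kappa> * norm v) \<or> (\<forall>y\<in>B. v \<bullet> \<phi> y \<le> - \<kappa> * norm v)"
    and dense: "\<And>v e. e > 0 \<Longrightarrow> \<exists>m. norm (v - D m) \<le> e"
    and k1_pos: "k1 > 0" and k2_pos: "k2 > 0"
    and growth: "\<And>x. norm (\<phi> x) \<le> k1 * exp (k2 * \<bar>x\<bar>)"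
    and c_pos: "c > 0"
    and density: "\<And>l. l \<ge> l0 \<Longrightarrow> c * l \<le> measure lborel ({x. norm (\<phi> x) \<le> L} \<inter> {-l..l})"
begin

text \<open>One constant for both regimes: the first summand is the error bound without an estimate,
  the second is \<open>3 / \<kappa> / 2 ^ k\<close> times the radius \<open>L * 2 ^ Suc k\<close> of
  the next epoch.\<close>

definition accuracy :: real where
  "accuracy = norm \<theta> * L + 6 * L / \<kappa>"

text \<open>The product bounds the part of \<open>\<theta> \<bullet> \<phi> y\<close> that survives
  cancellation whenever \<open>norm (\<phi> y)\<close> is within the radius.\<close>

definition accurate :: "nat \<Rightarrow> nat \<Rightarrow> bool" where
  "accurate k e \<longleftrightarrow> norm (\<theta> - estimate e) * radius k e \<le> accuracy"

abbreviation loop :: "(nat \<Rightarrow> real) \<Rightarrow> (nat \<Rightarrow> real) \<Rightarrow> nat \<Rightarrow> real" where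
  "loop \<equiv> traj \<theta> y0"

abbreviation code :: "nat \<Rightarrow> (nat \<Rightarrow> real) \<Rightarrow> (nat \<Rightarrow> real) \<Rightarrow> nat" where
  "code k \<xi> \<eta> \<equiv> est k \<xi> (loop \<xi> \<eta>)"

lemma accurate_0: "accurate k 0"
  using L_pos \<kappa>_pos by (simp add: accurate_def accuracy_def estimate_def radius_def)

lemma radius_ge: "L \<le> radius k e"
  using L_pos by (simp add: radius_def mult_le_cancel_left1)

text \<open>The input drops out, whether it was a cancellation or a dither, leaving only the
  parameter error and the noise.\<close>

lemma residual_loop:
  "residual k (code k \<xi> \<eta>) m B \<xi> (loop \<xi> \<eta>) =
    (\<theta> - D m) \<bullet> (\<Sum>t\<in>window k. indicat_real B (loop \<xi> \<eta> t) *\<^sub>R \<phi> (loop \<xi> \<eta> t))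
    + (\<Sum>t\<in>window k. indicator B (loop \<xi> \<eta> t) * \<eta> t)"
  unfolding residual_def inner_sum_right sum.distrib[symmetric]
  by (intro sum.cong refl) (simp add: traj_Suc_window inner_diff_left algebra_simps)

text \<open>In the bin belonging to the error \<open>v\<close> all visits contribute with one sign,
  so the signal is at least \<open>\<kappa> * norm v * 16 ^ k\<close>. The test and the noise bound
  together allow at most \<open>3 * 8 ^ k\<close>.\<close>

lemma accepted_accurate:
  assumes noise: "\<And>B. B \<in> \<B> \<Longrightarrow> \<bar>\<Sum>t\<in>window k. indicator B (loop \<xi> \<eta> t) * \<eta> t\<bar> \<le> 8 ^ k"
    and acc: "accept k (code k \<xi> \<eta>) m \<xi> (loop \<xi> \<eta>)"
  shows "norm (\<theta> - D m) \<le> 3 / \<kappa> / 2 ^ k"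
proof -
  let ?y = "loop \<xi> \<eta>" and ?v = "\<theta> - D m"
  obtain B where B: "B \<in> \<B>"
    and sgn: "(\<forall>y\<in>B. ?v \<bullet> \<phi> y \<ge> \<kappa> * norm ?v) \<or> (\<forall>y\<in>B. ?v \<bullet> \<phi> y \<le> - \<kappa> * norm ?v)"
    using informative[of ?v] by blast
  define X where "X = (\<Sum>t\<in>window k. indicat_real B (?y t) *\<^sub>R \<phi> (?y t))"
  define W where "W = (\<Sum>t\<in>window k. indicator B (?y t) * \<eta> t)"
  have vis: "16 ^ k \<le> visits k B ?y" and res: "\<bar>?v \<bullet> X + W\<bar> \<le> 2 * 8 ^ k"
    using acc B unfolding accept_def residual_loop X_def W_def by auto
  have "\<bar>W\<bar> \<le> 8 ^ k" unfolding W_def by (rule noise) (rule B)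
  with res have upper: "\<bar>?v \<bullet> X\<bar> \<le> 3 * 8 ^ k" by linarith
  have X_eq: "?v \<bullet> X = (\<Sum>t\<in>window k. indicator B (?y t) * (?v \<bullet> \<phi> (?y t)))"
    by (simp add: X_def inner_sum_right)
  have "\<kappa> * norm ?v * visits k B ?y \<le> \<bar>?v \<bullet> X\<bar>"
    using sgn
  proof
    assume "\<forall>y\<in>B. ?v \<bullet> \<phi> y \<ge> \<kappa> * norm ?v"
    then have "(\<Sum>t\<in>window k. indicator B (?y t) * (\<kappa> * norm ?v)) \<le> ?v \<bullet> X"
      unfolding X_eq by (intro sum_mono) (auto simp: indicator_def)
    then have "visits k B ?y * (\<kappa> * norm ?v) \<le> ?v \<bullet> X"
      unfolding visits_def sum_distrib_right .
    then show ?thesis by (simp add: mult.commute mult.left_commute)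
  next
    assume "\<forall>y\<in>B. ?v \<bullet> \<phi> y \<le> - \<kappa> * norm ?v"
    then have "?v \<bullet> X \<le> (\<Sum>t\<in>window k. indicator B (?y t) * (- \<kappa> * norm ?v))"
      unfolding X_eq by (intro sum_mono) (auto simp: indicator_def)
    then have "?v \<bullet> X \<le> visits k B ?y * (- \<kappa> * norm ?v)"
      unfolding visits_def sum_distrib_right .
    then show ?thesis by (simp add: mult.commute mult.left_commute)
  qed
  moreover have "\<kappa> * norm ?v * 16 ^ k \<le> \<kappa> * norm ?v * visits k B ?y"
    using vis \<kappa>_pos by (intro mult_left_mono) auto
  ultimately have "\<kappa> * norm ?v * 16 ^ k \<le> 3 * 8 ^ k" using upper by linarith
  moreover have "(16::real) ^ k = 2 ^ k * 8 ^ k" by (simp flip: power_mult_distrib)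
  ultimately have "\<kappa> * norm ?v * 2 ^ k * 8 ^ k \<le> 3 * 8 ^ k" by (simp add: mult.assoc)
  then have "\<kappa> * norm ?v * 2 ^ k \<le> 3" by (rule mult_right_le_imp_le) simp
  then show ?thesis using \<kappa>_pos by (simp add: field_simps)
qed

text \<open>No assumption on visits is made: either the test has certified them, or the code is 0
  and accuracy is automatic.\<close>

lemma code_Suc_accurate:
  assumes noise: "\<And>B. B \<in> \<B> \<Longrightarrow> \<bar>\<Sum>t\<in>window k. indicator B (loop \<xi> \<eta> t) * \<eta> t\<bar> \<le> 8 ^ k"
  shows "accurate (Suc k) (code (Suc k) \<xi> \<eta>)"
proof (cases "\<exists>m. accept k (code k \<xi> \<eta>) m \<xi> (loop \<xi> \<eta>)")
  case True
  define m where "m = (LEAST m. accept k (code k \<xi> \<eta>) m \<xi> (loop \<xi> \<eta>))"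
  have "accept k (code k \<xi> \<eta>) m \<xi> (loop \<xi> \<eta>)"
    unfolding m_def using True by (rule LeastI_ex)
  then have "norm (\<theta> - D m) \<le> 3 / \<kappa> / 2 ^ k" by (rule accepted_accurate[rotated]) (rule noise)
  then have "norm (\<theta> - D m) * (L * 2 ^ Suc k) \<le> 3 / \<kappa> / 2 ^ k * (L * 2 ^ Suc k)"
    using L_pos by (intro mult_right_mono) auto
  also have "\<dots> = 6 * L / \<kappa>" by simp
  also have "\<dots> \<le> accuracy" using L_pos by (simp add: accuracy_def)
  finally show ?thesis using True
    by (simp add: m_def[symmetric] accurate_def estimate_def radius_def)
next
  case False
  then show ?thesis by (simp add: accurate_0)
qed

text \<open>By density some candidate is so close to \<theta> that its signal is at most
  \<open>8 ^ k\<close> on this particular trajectory. Signal plus noise is then within the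
  \<open>2 * 8 ^ k\<close> that \<open>accept\<close> allows.\<close>

lemma code_Suc_nonzero:
  assumes noise: "\<And>B. B \<in> \<B> \<Longrightarrow> \<bar>\<Sum>t\<in>window k. indicator B (loop \<xi> \<eta> t) * \<eta> t\<bar> \<le> 8 ^ k"
    and vis: "\<And>B. B \<in> \<B> \<Longrightarrow> 16 ^ k \<le> visits k B (loop \<xi> \<eta>)"
  shows "code (Suc k) \<xi> \<eta> \<noteq> 0"
proof -
  let ?y = "loop \<xi> \<eta>"
  define F where "F = (\<Sum>t\<in>window k. norm (\<phi> (?y t)))"
  have "F \<ge> 0" unfolding F_def by (intro sum_nonneg) auto
  then have "0 < 8 ^ k / (1 + F)" by (intro divide_pos_pos) auto
  then obtain m where m: "norm (\<theta> - D m) \<le> 8 ^ k / (1 + F)"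
    using dense by blast
  have "accept k (code k \<xi> \<eta>) m \<xi> ?y"
    unfolding accept_def residual_loop
  proof (intro ballI conjI vis)
    fix B assume B: "B \<in> \<B>"
    let ?X = "\<Sum>t\<in>window k. indicat_real B (?y t) *\<^sub>R \<phi> (?y t)"
    have "norm ?X \<le> F"
      unfolding F_def by (rule sum_norm_le) (auto simp: indicator_def)
    then have "\<bar>(\<theta> - D m) \<bullet> ?X\<bar> \<le> 8 ^ k / (1 + F) * F"
      using m \<open>F \<ge> 0\<close> by (intro order_trans[OF Cauchy_Schwarz_ineq2] mult_mono) auto
    also have "\<dots> \<le> 8 ^ k" using \<open>F \<ge> 0\<close> by (simp add: field_simps)
    finally show "\<bar>(\<theta> - D m) \<bullet> ?X + (\<Sum>t\<in>window k. indicator B (?y t) * \<eta> t)\<bar> \<le> 2 * 8 ^ k"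
      using noise[OF B] by linarith
  qed
  then show ?thesis by auto
qed

lemma loop_step:
  assumes t: "t \<in> window k" and "accurate k (code k \<xi> \<eta>)"
    and "norm (\<phi> (loop \<xi> \<eta> t)) \<le> radius k (code k \<xi> \<eta>)"
  shows "\<bar>loop \<xi> \<eta> (Suc t)\<bar> \<le> accuracy + \<bar>\<eta> t\<bar>"
proof -
  let ?v = "\<theta> - estimate (code k \<xi> \<eta>)"
  have "loop \<xi> \<eta> (Suc t) = ?v \<bullet> \<phi> (loop \<xi> \<eta> t) + \<eta> t"
    using assms by (simp add: traj_Suc_window control_def inner_diff_left)
  moreover have "\<bar>?v \<bullet> \<phi> (loop \<xi> \<eta> t)\<bar> \<le> norm ?v * norm (\<phi> (loop \<xi> \<eta> t))"
    by (rule Cauchy_Schwarz_ineq2)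
  moreover have "\<dots> \<le> norm ?v * radius k (code k \<xi> \<eta>)"
    using assms(3) by (intro mult_left_mono) auto
  ultimately show ?thesis using assms(2) unfolding accurate_def by linarith
qed

text \<open>The finitely many early outputs, possibly huge because of the dither, are absorbed into
  the constant; the others satisfy
  \<open>y\<^sup>2 \<le> 2 * C\<^sup>2 + 2 * \<eta>\<^sup>2\<close>.\<close>

lemma sum_squares_bounded:
  fixes y \<eta> :: "nat \<Rightarrow> real"
  assumes y: "eventually (\<lambda>t. \<bar>y (Suc t)\<bar> \<le> C + \<bar>\<eta> t\<bar>) sequentially"
    and \<eta>: "eventually (\<lambda>t. (\<Sum>i<t. (\<eta> i)\<^sup>2) \<le> K * real t) sequentially"
  shows "\<exists>K. \<forall>t\<ge>1. (\<Sum>i=1..t. (y i)\<^sup>2) \<le> K * real t"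
proof -
  obtain T where T: "\<And>t. t \<ge> T \<Longrightarrow> \<bar>y (Suc t)\<bar> \<le> C + \<bar>\<eta> t\<bar>"
    using y by (auto simp: eventually_sequentially)
  obtain T' where T': "\<And>t. t \<ge> T' \<Longrightarrow> (\<Sum>i<t. (\<eta> i)\<^sup>2) \<le> K * real t"
    using \<eta> by (auto simp: eventually_sequentially)
  define A where "A = (\<Sum>i<T. (y (Suc i))\<^sup>2)"
  define A' where "A' = (\<Sum>i<T'. (\<eta> i)\<^sup>2)"
  have pos: "A \<ge> 0" "A' \<ge> 0" by (auto simp: A_def A'_def intro: sum_nonneg)
  have \<eta>': "(\<Sum>i<t. (\<eta> i)\<^sup>2) \<le> (\<bar>K\<bar> + A') * real t" if "t \<ge> 1" for t
  proof (cases "t \<ge> T'")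
    case True
    have "K * real t \<le> (\<bar>K\<bar> + A') * real t" using pos by (intro mult_right_mono) auto
    then show ?thesis using T'[OF True] by linarith
  next
    case False
    then have "(\<Sum>i<t. (\<eta> i)\<^sup>2) \<le> A'" unfolding A'_def by (intro sum_mono2) auto
    also have "\<dots> \<le> (\<bar>K\<bar> + A') * 1" by simp
    also have "\<dots> \<le> (\<bar>K\<bar> + A') * real t" using pos that by (intro mult_left_mono) auto
    finally show ?thesis .
  qed
  have "(\<Sum>i=1..t. (y i)\<^sup>2) \<le> (A + 2 * C\<^sup>2 + 2 * (\<bar>K\<bar> + A')) * real t" if t: "t \<ge> 1" for t
  proof -
    have "(\<Sum>i=1..t. (y i)\<^sup>2) = (\<Sum>i<t. (y (Suc i))\<^sup>2)"
      by (rule sum.reindex_bij_witness[of _ Suc "\<lambda>i. i - 1"]) auto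
    also have "\<dots> \<le> (\<Sum>i<t. (if i < T then (y (Suc i))\<^sup>2 else 0) + (2 * C\<^sup>2 + 2 * (\<eta> i)\<^sup>2))"
    proof (rule sum_mono)
      fix i
      show "(y (Suc i))\<^sup>2 \<le> (if i < T then (y (Suc i))\<^sup>2 else 0) + (2 * C\<^sup>2 + 2 * (\<eta> i)\<^sup>2)"
      proof (cases "i < T")
        case False
        then have "\<bar>y (Suc i)\<bar>\<^sup>2 \<le> (C + \<bar>\<eta> i\<bar>)\<^sup>2" using T[of i] by (intro power_mono) auto
        also have "\<dots> \<le> 2 * C\<^sup>2 + 2 * \<bar>\<eta> i\<bar>\<^sup>2"
          using sum_squares_ge_zero[of "C - \<bar>\<eta> i\<bar>" 0] by (simp add: power2_eq_square algebra_simps)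
        finally show ?thesis using False by simp
      qed simp
    qed
    also have "\<dots> = (\<Sum>i\<in>{..<t} \<inter> {..<T}. (y (Suc i))\<^sup>2) + (2 * C\<^sup>2 * real t + 2 * (\<Sum>i<t. (\<eta> i)\<^sup>2))"
    proof -
      have "(\<Sum>i<t. if i < T then (y (Suc i))\<^sup>2 else 0) = (\<Sum>i\<in>{..<t} \<inter> {..<T}. (y (Suc i))\<^sup>2)"
        by (simp add: sum.If_cases Int_def lessThan_def)
      then show ?thesis by (simp add: sum.distrib sum_distrib_left)
    qed
    also have "\<dots> \<le> A + (2 * C\<^sup>2 * real t + 2 * ((\<bar>K\<bar> + A') * real t))"
      unfolding A_def by (intro add_mono sum_mono2 mult_left_mono \<eta>' t) auto
    also have "\<dots> \<le> A * real t + (2 * C\<^sup>2 * real t + 2 * ((\<bar>K\<bar> + A') * real t))"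
      using pos t mult_left_mono[of 1 "real t" A] by simp
    finally show ?thesis by (simp add: algebra_simps)
  qed
  then show ?thesis by blast
qed

lemma loop_stable:
  assumes noise: "eventually (\<lambda>k. \<forall>B\<in>\<B>. \<bar>\<Sum>t\<in>window k. indicator B (loop \<xi> \<eta> t) * \<eta> t\<bar> \<le> 8 ^ k) sequentially"
    and tails: "eventually (\<lambda>k. \<forall>t\<in>window k. \<bar>\<eta> t\<bar> \<le> real k / (4 * k2)) sequentially"
    and vis: "eventually (\<lambda>k. accurate k (code k \<xi> \<eta>) \<longrightarrow>
      (\<forall>B\<in>\<B>. 16 ^ k \<le> visits k B (loop \<xi> \<eta>))) sequentially"
    and squares: "eventually (\<lambda>t. (\<Sum>i<t. (\<eta> i)\<^sup>2) \<le> K * real t) sequentially"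
  shows "\<exists>K. \<forall>t\<ge>1. (\<Sum>i=1..t. (loop \<xi> \<eta> i)\<^sup>2) \<le> K * real t"
proof -
  let ?y = "loop \<xi> \<eta>"
  have "eventually (\<lambda>k. k1 * exp (k2 * accuracy + real k / 4) \<le> L * 2 ^ k) sequentially"
  proof -
    \<comment> \<open>This dictates the threshold \<open>real k / (4 * k2)\<close> on the noise: the
      growth bound turns it into \<open>exp (1 / 4) ^ k\<close>, which must lose against
      \<open>2 ^ k\<close>.\<close>
    have "exp (1 / 4 :: real) < 2"
      using exp_ge_add_one_self[of "- (1 / 4) :: real"] by (simp add: exp_minus field_simps)
    then have "(\<lambda>k. (exp (1 / 4) / 2 :: real) ^ k) \<longlonglongrightarrow> 0" by (intro LIMSEQ_realpow_zero) auto
    then have "(\<lambda>k. k1 * exp (k2 * accuracy) * (exp (1 / 4) / 2) ^ k) \<longlonglongrightarrow> 0"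
      by (rule tendsto_mult_right_zero)
    then have "eventually (\<lambda>k. k1 * exp (k2 * accuracy) * (exp (1 / 4) / 2) ^ k < L) sequentially"
      using L_pos by (rule order_tendstoD)
    then show ?thesis
    proof eventually_elim
      case (elim k)
      have "exp (k2 * accuracy + real k / 4) = exp (k2 * accuracy) * exp (1 / 4) ^ k"
        by (simp add: exp_add flip: exp_of_nat_mult)
      then show ?case using elim by (simp add: power_divide pos_divide_less_eq mult.assoc)
    qed
  qed
  moreover have "eventually (\<lambda>k. b \<le> L * 2 ^ k) sequentially"
    using L_pos by real_asymp
  ultimately have "eventually (\<lambda>k.
      (\<forall>B\<in>\<B>. \<bar>\<Sum>t\<in>window k. indicator B (?y t) * \<eta> t\<bar> \<le> 8 ^ k) \<and>
      (\<forall>t\<in>window k. \<bar>\<eta> t\<bar> \<le> real k / (4 * k2)) \<and>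
      (accurate k (code k \<xi> \<eta>) \<longrightarrow> (\<forall>B\<in>\<B>. 16 ^ k \<le> visits k B ?y)) \<and>
      k1 * exp (k2 * accuracy + real k / 4) \<le> L * 2 ^ k \<and> b \<le> L * 2 ^ k) sequentially"
    using noise tails vis by eventually_elim auto
  then obtain k0 where k0: "\<And>k. k \<ge> k0 \<Longrightarrow>
      (\<forall>B\<in>\<B>. \<bar>\<Sum>t\<in>window k. indicator B (?y t) * \<eta> t\<bar> \<le> 8 ^ k) \<and>
      (\<forall>t\<in>window k. \<bar>\<eta> t\<bar> \<le> real k / (4 * k2)) \<and>
      (accurate k (code k \<xi> \<eta>) \<longrightarrow> (\<forall>B\<in>\<B>. 16 ^ k \<le> visits k B ?y)) \<and>
      k1 * exp (k2 * accuracy + real k / 4) \<le> L * 2 ^ k \<and> b \<le> L * 2 ^ k"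
    by (auto simp: eventually_sequentially)
  have acc: "accurate k (code k \<xi> \<eta>)" if k: "k \<ge> Suc k0" for k
  proof -
    obtain j where j: "k = Suc j" "j \<ge> k0" using k by (cases k) auto
    have "accurate (Suc j) (code (Suc j) \<xi> \<eta>)"
      by (rule code_Suc_accurate) (use k0[of j] j in auto)
    then show ?thesis using j by simp
  qed
  have vis': "16 ^ k \<le> visits k B ?y" if "k \<ge> Suc k0" "B \<in> \<B>" for k B
    using that k0[of k] acc[of k] by auto
  \<comment> \<open>One epoch later than accuracy: the code of an epoch comes from the visits of the
    preceding one, and these required an accurate code there.\<close>
  have nz: "code k \<xi> \<eta> \<noteq> 0" if k: "k \<ge> Suc (Suc k0)" for k
  proof -
    obtain j where j: "k = Suc j" "j \<ge> Suc k0" using k by (cases k) auto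
    have "code (Suc j) \<xi> \<eta> \<noteq> 0"
      by (rule code_Suc_nonzero) (use k0[of j] vis'[of j] j in auto)
    then show ?thesis using j by simp
  qed
  have rad: "radius k (code k \<xi> \<eta>) = L * 2 ^ k" if "k \<ge> Suc (Suc k0)" for k
    using nz[OF that] by (simp add: radius_def)
  define K where "K = Suc (Suc k0)"
  obtain B where "B \<in> \<B>" using informative by blast
  \<comment> \<open>A visit to any bin marks the entry into the good regime, since there
    \<open>norm (\<phi> y) \<le> b\<close>, which is within the radius by now.\<close>
  have "\<exists>t\<in>window K. ?y t \<in> B"
  proof (rule ccontr)
    assume "\<not> ?thesis"
    then have "visits K B ?y = 0" unfolding visits_def by (intro sum.neutral) auto
    moreover have "16 ^ K \<le> visits K B ?y" using vis'[of K B] \<open>B \<in> \<B>\<close> by (simp add: K_def)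
    moreover have "(0::real) < 16 ^ K" by simp
    ultimately show False by linarith
  qed
  then obtain s where s: "s \<in> window K" "?y s \<in> B" by blast
  have "s \<ge> 1" using s(1) one_le_power[of "32::nat" K] by (auto simp: window_def)
  have epoch_ge: "K \<le> epoch t" if "t \<ge> s" for t
  proof (rule ccontr)
    assume "\<not> K \<le> epoch t"
    then have "(32::nat) ^ Suc (epoch t) \<le> 32 ^ K" by (intro power_increasing) auto
    moreover have "t < 32 ^ Suc (epoch t)"
      using window_epoch[of t] that \<open>s \<ge> 1\<close> by (simp add: window_def)
    moreover have "32 ^ K \<le> s" using s(1) by (simp add: window_def)
    ultimately show False using that by linarith
  qed
  \<comment> \<open>The radius of the current epoch confines the next output to
    \<open>accuracy\<close> plus noise; the growth bound returns it to the same radius, and a change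
    of epoch only enlarges the radius.\<close>
  have zone: "norm (\<phi> (?y t)) \<le> L * 2 ^ epoch t" if "t \<ge> s" for t
    using that
  proof (induction t rule: dec_induct)
    case base
    then show ?case using \<phi>_bins[OF \<open>B \<in> \<B>\<close> s(2)] k0[of K] s(1) by (auto simp: epoch_window K_def)
  next
    case (step t)
    define k where "k = epoch t"
    have k: "t \<in> window k" "k \<ge> K"
      using window_epoch[of t] epoch_ge[of t] step \<open>s \<ge> 1\<close> by (auto simp: k_def)
    have "\<bar>?y (Suc t)\<bar> \<le> accuracy + \<bar>\<eta> t\<bar>"
      by (rule loop_step[OF k(1)]) (use acc[of k] rad[of k] k step.IH in \<open>auto simp: K_def k_def\<close>)
    also have "\<dots> \<le> accuracy + real k / (4 * k2)"
      using k0[of k] k by (auto simp: K_def)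
    finally have "k2 * \<bar>?y (Suc t)\<bar> \<le> k2 * (accuracy + real k / (4 * k2))"
      using k2_pos by (intro mult_left_mono) auto
    also have "\<dots> = k2 * accuracy + real k / 4" using k2_pos by (simp add: field_simps)
    finally have "norm (\<phi> (?y (Suc t))) \<le> k1 * exp (k2 * accuracy + real k / 4)"
      using growth[of "?y (Suc t)"] k1_pos by (smt (verit) exp_le_cancel_iff mult_left_mono)
    also have "\<dots> \<le> L * 2 ^ k" using k0[of k] k by (auto simp: K_def)
    also have "\<dots> \<le> L * 2 ^ epoch (Suc t)"
    proof -
      have "k \<le> epoch (Suc t)"
      proof (rule ccontr)
        assume "\<not> k \<le> epoch (Suc t)"
        then have "(32::nat) ^ Suc (epoch (Suc t)) \<le> 32 ^ k" by (intro power_increasing) auto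
        then show False using window_epoch[of "Suc t"] k(1) by (simp add: window_def)
      qed
      then show ?thesis using L_pos by simp
    qed
    finally show ?case .
  qed
  have "eventually (\<lambda>t. \<bar>?y (Suc t)\<bar> \<le> accuracy + \<bar>\<eta> t\<bar>) sequentially"
    unfolding eventually_sequentially
  proof (intro exI[of _ s] allI impI)
    fix t assume t: "s \<le> t"
    have "t \<in> window (epoch t)" "Suc (Suc k0) \<le> epoch t"
      using window_epoch[of t] epoch_ge[of t] t \<open>s \<ge> 1\<close> by (auto simp: K_def)
    then show "\<bar>?y (Suc t)\<bar> \<le> accuracy + \<bar>\<eta> t\<bar>"
      using zone[OF t] rad[of "epoch t"] acc[of "epoch t"] by (intro loop_step) auto
  qed
  then show ?thesis using squares by (rule sum_squares_bounded)
qed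

end

section \<open>Exponential moment bounds\<close>

lemma emeasure_le_nn_integral:
  assumes "A \<in> sets M" "\<And>x. x \<in> A \<Longrightarrow> 1 \<le> u x"
  shows "emeasure M A \<le> (\<integral>\<^sup>+x. u x \<partial>M)"
proof -
  have "emeasure M A = (\<integral>\<^sup>+x. indicator A x \<partial>M)" using assms(1) by simp
  also have "\<dots> \<le> (\<integral>\<^sup>+x. u x \<partial>M)"
    by (intro nn_integral_mono) (auto simp: indicator_def assms(2))
  finally show ?thesis .
qed

text \<open>Borel-Cantelli with a geometric majorant, so that each application only needs an
  asymptotic inequality between explicit functions.\<close>

lemma (in finite_measure) AE_eventually_notin:
  assumes A [measurable]: "\<And>n. A n \<in> sets M"
    and "eventually (\<lambda>n. emeasure M (A n) \<le> ennreal (f n)) sequentially"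
    and "eventually (\<lambda>n. f n \<le> (1 / 2) ^ n) sequentially"
  shows "AE x in M. eventually (\<lambda>n. x \<notin> A n) sequentially"
proof -
  have "eventually (\<lambda>n. norm (measure M (A n)) \<le> (1 / 2) ^ n) sequentially"
    using assms(2,3)
  proof eventually_elim
    case (elim n)
    then have "emeasure M (A n) \<le> ennreal ((1 / 2) ^ n)"
      by (meson ennreal_leI order_trans)
    then show ?case by (simp add: emeasure_eq_measure)
  qed
  then have "summable (\<lambda>n. measure M (A n))"
    by (rule summable_comparison_test_ev) (simp add: summable_geometric)
  then have "AE x in M. eventually (\<lambda>n. x \<in> space M - A n) sequentially"
    by (intro borel_cantelli_AE1) (auto simp: emeasure_eq_measure)
  then show ?thesis by eventually_elim (auto elim: eventually_mono)
qed

text \<open>A one-step conditional bound, iterated: \<open>g t\<close> expresses the next value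
  through the past and the current pair, and integrating out this pair costs a factor
  \<open>\<rho>\<close>. Factors above 1 give moment bounds, factors below 1 give decay.\<close>

lemma (in sequence_space) nn_integral_geometric:
  fixes V :: "nat \<Rightarrow> (nat \<Rightarrow> 'a) \<times> (nat \<Rightarrow> 'a) \<Rightarrow> ennreal"
  assumes [measurable]: "\<And>t. V t \<in> borel_measurable (S \<Otimes>\<^sub>M S)"
    and g: "\<And>t. g t \<in> borel_measurable ((S \<Otimes>\<^sub>M S) \<Otimes>\<^sub>M (M \<Otimes>\<^sub>M M))"
    and past: "\<And>t \<xi> \<xi>' \<eta> \<eta>' z. a \<le> t \<Longrightarrow> (\<And>i. i < t \<Longrightarrow> \<xi> i = \<xi>' i) \<Longrightarrow> (\<And>i. i < t \<Longrightarrow> \<eta> i = \<eta>' i)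
      \<Longrightarrow> g t ((\<xi>, \<eta>), z) = g t ((\<xi>', \<eta>'), z)"
    and step: "\<And>t p. a \<le> t \<Longrightarrow> t < a + m \<Longrightarrow> V (Suc t) p = g t (p, (fst p t, snd p t))"
    and bound: "\<And>t p. a \<le> t \<Longrightarrow> t < a + m \<Longrightarrow> (\<integral>\<^sup>+x. (\<integral>\<^sup>+z. g t (p, (x, z)) \<partial>M) \<partial>M) \<le> \<rho> * V t p"
  shows "(\<integral>\<^sup>+p. V (a + m) p \<partial>(S \<Otimes>\<^sub>M S)) \<le> \<rho> ^ m * (\<integral>\<^sup>+p. V a p \<partial>(S \<Otimes>\<^sub>M S))"
  using step bound
proof (induction m)
  case (Suc m)
  have IH: "(\<integral>\<^sup>+p. V (a + m) p \<partial>(S \<Otimes>\<^sub>M S)) \<le> \<rho> ^ m * (\<integral>\<^sup>+p. V a p \<partial>(S \<Otimes>\<^sub>M S))"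
    by (rule Suc.IH) (use Suc.prems in auto)
  have "(\<integral>\<^sup>+p. V (a + Suc m) p \<partial>(S \<Otimes>\<^sub>M S)) =
      (\<integral>\<^sup>+p. g (a + m) (p, (fst p (a + m), snd p (a + m))) \<partial>(S \<Otimes>\<^sub>M S))"
    using Suc.prems(1)[of "a + m"] by simp
  also have "\<dots> = (\<integral>\<^sup>+p. (\<integral>\<^sup>+x. (\<integral>\<^sup>+z. g (a + m) (p, (x, z)) \<partial>M) \<partial>M) \<partial>(S \<Otimes>\<^sub>M S))"
    by (rule nn_integral_past2[OF g]) (rule past, auto)
  also have "\<dots> \<le> (\<integral>\<^sup>+p. \<rho> * V (a + m) p \<partial>(S \<Otimes>\<^sub>M S))"
    by (intro nn_integral_mono Suc.prems(2)) auto
  also have "\<dots> = \<rho> * (\<integral>\<^sup>+p. V (a + m) p \<partial>(S \<Otimes>\<^sub>M S))"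
    by (rule nn_integral_cmult) measurable
  also have "\<dots> \<le> \<rho> * (\<rho> ^ m * (\<integral>\<^sup>+p. V a p \<partial>(S \<Otimes>\<^sub>M S)))"
    by (intro mult_left_mono IH) auto
  finally show ?case by (simp add: mult.assoc)
qed simp

section \<open>Chernoff bounds for predictable noise sums and for sums of squares\<close>

abbreviation gauss_seq :: "real \<Rightarrow> (nat \<Rightarrow> real) measure" where
  "gauss_seq \<sigma> \<equiv> Pi\<^sub>M UNIV (\<lambda>_. gauss \<sigma>)"

lemma sets_gauss_seq [measurable_cong]: "sets (gauss_seq \<sigma>) = sets real_seq"
  by (intro sets_PiM_cong) auto

lemma sequence_space_gauss: "\<sigma> > 0 \<Longrightarrow> sequence_space (gauss \<sigma>)"
  by (intro sequence_space.intro product_prob_spaceI prob_space_gauss)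

lemma prob_space_gauss_pair: "\<sigma> > 0 \<Longrightarrow> prob_space (gauss_seq \<sigma> \<Otimes>\<^sub>M gauss_seq \<sigma>)"
  by (intro prob_space_pair prob_space_PiM prob_space_gauss)

lemma emeasure_gauss_UNIV [simp]: "\<sigma> > 0 \<Longrightarrow> emeasure (gauss \<sigma>) UNIV = 1"
  using prob_space.emeasure_space_1[OF prob_space_gauss] by (simp add: space_gauss)

text \<open>The weight \<open>h t\<close> is predictable, hence constant when the noise at
  \<open>t\<close> is integrated out; as it is at most 1 in modulus, each step costs no more than
  the unweighted Gaussian moment.\<close>

lemma noise_sum_exp:
  fixes h :: "nat \<Rightarrow> (nat \<Rightarrow> real) \<times> (nat \<Rightarrow> real) \<Rightarrow> real"
  assumes \<sigma>: "\<sigma> > 0"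
    and h [measurable]: "\<And>t. h t \<in> borel_measurable (gauss_seq \<sigma> \<Otimes>\<^sub>M gauss_seq \<sigma>)"
    and h_le: "\<And>t p. \<bar>h t p\<bar> \<le> 1"
    and past: "\<And>t \<xi> \<xi>' \<eta> \<eta>'. (\<And>i. i < t \<Longrightarrow> \<xi> i = \<xi>' i) \<Longrightarrow> (\<And>i. i < t \<Longrightarrow> \<eta> i = \<eta>' i)
      \<Longrightarrow> h t (\<xi>, \<eta>) = h t (\<xi>', \<eta>')"
  shows "(\<integral>\<^sup>+p. ennreal (exp (l * (\<Sum>t\<in>{a..<a + m}. h t p * snd p t))) \<partial>(gauss_seq \<sigma> \<Otimes>\<^sub>M gauss_seq \<sigma>))
    \<le> ennreal (exp (l\<^sup>2 * \<sigma>\<^sup>2 / 2)) ^ m"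
proof -
  interpret sequence_space "gauss \<sigma>" using \<sigma> by (rule sequence_space_gauss)
  interpret GG: prob_space "gauss_seq \<sigma> \<Otimes>\<^sub>M gauss_seq \<sigma>" using \<sigma> by (rule prob_space_gauss_pair)
  define V where "V t p = ennreal (exp (l * (\<Sum>i\<in>{a..<t}. h i p * snd p i)))" for t p
  define g :: "nat \<Rightarrow> ((nat \<Rightarrow> real) \<times> (nat \<Rightarrow> real)) \<times> (real \<times> real) \<Rightarrow> ennreal"
    where "g t q = V t (fst q) * ennreal (exp (l * h t (fst q) * snd (snd q)))" for t q
  have [measurable]: "V t \<in> borel_measurable (gauss_seq \<sigma> \<Otimes>\<^sub>M gauss_seq \<sigma>)" for t
    unfolding V_def by measurable
  have "(\<integral>\<^sup>+p. V (a + m) p \<partial>(gauss_seq \<sigma> \<Otimes>\<^sub>M gauss_seq \<sigma>)) \<le> ennreal (exp (l\<^sup>2 * \<sigma>\<^sup>2 / 2)) ^ m *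
     (\<integral>\<^sup>+p. V a p \<partial>(gauss_seq \<sigma> \<Otimes>\<^sub>M gauss_seq \<sigma>))"
  proof (rule nn_integral_geometric[where g = g])
    show "g t \<in> borel_measurable ((gauss_seq \<sigma> \<Otimes>\<^sub>M gauss_seq \<sigma>) \<Otimes>\<^sub>M (gauss \<sigma> \<Otimes>\<^sub>M gauss \<sigma>))" for t
      unfolding g_def by measurable
  next
    fix t and \<xi> \<xi>' \<eta> \<eta>' :: "nat \<Rightarrow> real" and z :: "real \<times> real"
    assume eq: "\<And>i. i < t \<Longrightarrow> \<xi> i = \<xi>' i" "\<And>i. i < t \<Longrightarrow> \<eta> i = \<eta>' i"
    have "h i (\<xi>, \<eta>) = h i (\<xi>', \<eta>')" if "i \<le> t" for i
      by (rule past) (use eq that in auto)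
    then show "g t ((\<xi>, \<eta>), z) = g t ((\<xi>', \<eta>'), z)"
      unfolding g_def V_def using eq by simp
  next
    fix t p assume "a \<le> t"
    then show "V (Suc t) p = g t (p, fst p t, snd p t)"
      by (simp add: g_def V_def sum.atLeastLessThan_Suc distrib_left exp_add ennreal_mult mult.assoc)
  next
    fix t p
    have "(\<integral>\<^sup>+x. (\<integral>\<^sup>+z. g t (p, x, z) \<partial>gauss \<sigma>) \<partial>gauss \<sigma>) =
        V t p * (\<integral>\<^sup>+z. ennreal (exp (l * h t p * z)) \<partial>gauss \<sigma>)"
      unfolding g_def using \<sigma> by (simp add: nn_integral_cmult)
    also have "\<dots> = V t p * ennreal (exp ((l * h t p)\<^sup>2 * \<sigma>\<^sup>2 / 2))"
      by (subst gauss_exp_linear[OF \<sigma>]) simp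
    also have "\<dots> \<le> V t p * ennreal (exp (l\<^sup>2 * \<sigma>\<^sup>2 / 2))"
    proof -
      have "(h t p)\<^sup>2 \<le> 1" using h_le[of t p] by (simp add: abs_square_le_1)
      then have "(l * h t p)\<^sup>2 * \<sigma>\<^sup>2 / 2 \<le> l\<^sup>2 * \<sigma>\<^sup>2 / 2"
        by (simp add: power_mult_distrib mult_left_le divide_right_mono mult_right_mono)
      then show ?thesis by (intro mult_left_mono ennreal_leI) auto
    qed
    finally show "(\<integral>\<^sup>+x. (\<integral>\<^sup>+z. g t (p, x, z) \<partial>gauss \<sigma>) \<partial>gauss \<sigma>) \<le> ennreal (exp (l\<^sup>2 * \<sigma>\<^sup>2 / 2)) * V t p"
      by (simp add: mult.commute)
  qed measurable
  also have "(\<integral>\<^sup>+p. V a p \<partial>(gauss_seq \<sigma> \<Otimes>\<^sub>M gauss_seq \<sigma>)) = 1"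
    by (simp add: V_def GG.emeasure_space_1)
  finally show ?thesis by (simp add: V_def)
qed

lemma noise_sum_tail:
  fixes h :: "nat \<Rightarrow> (nat \<Rightarrow> real) \<times> (nat \<Rightarrow> real) \<Rightarrow> real"
  assumes \<sigma>: "\<sigma> > 0" and l: "l > 0"
    and h [measurable]: "\<And>t. h t \<in> borel_measurable (gauss_seq \<sigma> \<Otimes>\<^sub>M gauss_seq \<sigma>)"
    and h_le: "\<And>t p. \<bar>h t p\<bar> \<le> 1"
    and past: "\<And>t \<xi> \<xi>' \<eta> \<eta>'. (\<And>i. i < t \<Longrightarrow> \<xi> i = \<xi>' i) \<Longrightarrow> (\<And>i. i < t \<Longrightarrow> \<eta> i = \<eta>' i)
      \<Longrightarrow> h t (\<xi>, \<eta>) = h t (\<xi>', \<eta>')"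
  shows "emeasure (gauss_seq \<sigma> \<Otimes>\<^sub>M gauss_seq \<sigma>)
      {p \<in> space (gauss_seq \<sigma> \<Otimes>\<^sub>M gauss_seq \<sigma>). \<not> \<bar>\<Sum>t\<in>{a..<a + m}. h t p * snd p t\<bar> \<le> c}
    \<le> ennreal (2 * exp (- l * c + real m * (l\<^sup>2 * \<sigma>\<^sup>2 / 2)))" (is "emeasure ?P ?A \<le> _")
proof -
  define X where "X p = (\<Sum>t\<in>{a..<a + m}. h t p * snd p t)" for p
  have [measurable]: "X \<in> borel_measurable ?P" unfolding X_def[abs_def] by measurable
  have E: "(\<integral>\<^sup>+p. ennreal (exp (s * X p)) \<partial>?P) \<le> ennreal (exp (real m * (s\<^sup>2 * \<sigma>\<^sup>2 / 2)))" for s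
  proof -
    have "(\<integral>\<^sup>+p. ennreal (exp (s * X p)) \<partial>?P) \<le> ennreal (exp (s\<^sup>2 * \<sigma>\<^sup>2 / 2)) ^ m"
      unfolding X_def by (rule noise_sum_exp[OF \<sigma> h h_le past])
    then show ?thesis by (simp only: ennreal_power exp_ge_zero exp_of_nat_mult)
  qed
  \<comment> \<open>Markov's inequality for both signs at once.\<close>
  have "emeasure ?P ?A \<le> (\<integral>\<^sup>+p. ennreal (exp (- l * c)) * (ennreal (exp (l * X p)) + ennreal (exp (- l * X p))) \<partial>?P)"
  proof (rule emeasure_le_nn_integral)
    show "?A \<in> sets ?P" by measurable
    fix p assume "p \<in> ?A"
    then have "c < X p \<or> c < - X p" by (auto simp: X_def)
    then have "l * c \<le> l * X p \<or> l * c \<le> l * (- X p)"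
      using l by (elim disj_forward) (simp_all only: mult_le_cancel_left_pos less_imp_le)
    then have "1 \<le> exp (- l * c + l * X p) \<or> 1 \<le> exp (- l * c - l * X p)" by (auto simp del: exp_le_cancel_iff)
    then have "1 \<le> exp (- l * c) * (exp (l * X p) + exp (- l * X p))"
    proof
      assume "1 \<le> exp (- l * c + l * X p)"
      moreover have "0 \<le> exp (- l * c) * exp (- l * X p)" by simp
      ultimately show ?thesis unfolding exp_add distrib_left by linarith
    next
      assume "1 \<le> exp (- l * c - l * X p)"
      moreover have "exp (- l * c - l * X p) = exp (- l * c) * exp (- l * X p)" by (simp flip: exp_add)
      moreover have "0 \<le> exp (- l * c) * exp (l * X p)" by simp
      ultimately show ?thesis unfolding distrib_left by linarith
    qed
    then have "ennreal 1 \<le> ennreal (exp (- l * c) * (exp (l * X p) + exp (- l * X p)))" by (rule ennreal_leI)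
    then show "1 \<le> ennreal (exp (- l * c)) * (ennreal (exp (l * X p)) + ennreal (exp (- l * X p)))"
      by (simp add: ennreal_mult)
  qed
  also have "\<dots> = ennreal (exp (- l * c)) * ((\<integral>\<^sup>+p. ennreal (exp (l * X p)) \<partial>?P) + (\<integral>\<^sup>+p. ennreal (exp (- l * X p)) \<partial>?P))"
    by (simp add: nn_integral_cmult nn_integral_add)
  also have "\<dots> \<le> ennreal (exp (- l * c)) * (ennreal (exp (real m * (l\<^sup>2 * \<sigma>\<^sup>2 / 2))) + ennreal (exp (real m * ((- l)\<^sup>2 * \<sigma>\<^sup>2 / 2))))"
    by (intro mult_left_mono add_mono E) auto
  also have "\<dots> = ennreal (2 * exp (- l * c + real m * (l\<^sup>2 * \<sigma>\<^sup>2 / 2)))"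
    by (simp only: exp_add power2_minus mult_2 distrib_left exp_ge_zero mult_nonneg_nonneg add_nonneg_nonneg flip: ennreal_mult ennreal_plus)
  finally show ?thesis .
qed

lemma squares_exp:
  assumes \<sigma>: "\<sigma> > 0"
  shows "(\<integral>\<^sup>+p. ennreal (exp ((\<Sum>t\<in>{a..<a + m}. (snd p t)\<^sup>2) / (4 * \<sigma>\<^sup>2))) \<partial>(gauss_seq \<sigma> \<Otimes>\<^sub>M gauss_seq \<sigma>))
    \<le> ennreal (sqrt 2) ^ m"
proof -
  interpret sequence_space "gauss \<sigma>" using \<sigma> by (rule sequence_space_gauss)
  interpret GG: prob_space "gauss_seq \<sigma> \<Otimes>\<^sub>M gauss_seq \<sigma>" using \<sigma> by (rule prob_space_gauss_pair)
  define V :: "nat \<Rightarrow> (nat \<Rightarrow> real) \<times> (nat \<Rightarrow> real) \<Rightarrow> ennreal"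
    where "V t p = ennreal (exp ((\<Sum>i\<in>{a..<t}. (snd p i)\<^sup>2) / (4 * \<sigma>\<^sup>2)))" for t p
  define g :: "nat \<Rightarrow> ((nat \<Rightarrow> real) \<times> (nat \<Rightarrow> real)) \<times> (real \<times> real) \<Rightarrow> ennreal"
    where "g t q = V t (fst q) * ennreal (exp ((snd (snd q))\<^sup>2 / (4 * \<sigma>\<^sup>2)))" for t q
  have [measurable]: "V t \<in> borel_measurable (gauss_seq \<sigma> \<Otimes>\<^sub>M gauss_seq \<sigma>)" for t
    unfolding V_def by measurable
  have "(\<integral>\<^sup>+p. V (a + m) p \<partial>(gauss_seq \<sigma> \<Otimes>\<^sub>M gauss_seq \<sigma>)) \<le> ennreal (sqrt 2) ^ m *
     (\<integral>\<^sup>+p. V a p \<partial>(gauss_seq \<sigma> \<Otimes>\<^sub>M gauss_seq \<sigma>))"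
  proof (rule nn_integral_geometric[where g = g])
    show "g t \<in> borel_measurable ((gauss_seq \<sigma> \<Otimes>\<^sub>M gauss_seq \<sigma>) \<Otimes>\<^sub>M (gauss \<sigma> \<Otimes>\<^sub>M gauss \<sigma>))" for t
      unfolding g_def by measurable
  next
    fix t p assume "a \<le> t"
    then show "V (Suc t) p = g t (p, fst p t, snd p t)"
      by (simp add: g_def V_def sum.atLeastLessThan_Suc add_divide_distrib exp_add ennreal_mult)
  next
    fix t p
    show "(\<integral>\<^sup>+x. (\<integral>\<^sup>+z. g t (p, x, z) \<partial>gauss \<sigma>) \<partial>gauss \<sigma>) \<le> ennreal (sqrt 2) * V t p"
      unfolding g_def using \<sigma>
      by (simp add: nn_integral_cmult gauss_exp_square mult.commute)
  qed (auto simp: g_def V_def)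
  also have "(\<integral>\<^sup>+p. V a p \<partial>(gauss_seq \<sigma> \<Otimes>\<^sub>M gauss_seq \<sigma>)) = 1"
    by (simp add: V_def GG.emeasure_space_1)
  finally show ?thesis by (simp add: V_def)
qed

lemma squares_tail:
  assumes \<sigma>: "\<sigma> > 0"
  shows "emeasure (gauss_seq \<sigma> \<Otimes>\<^sub>M gauss_seq \<sigma>)
      {p \<in> space (gauss_seq \<sigma> \<Otimes>\<^sub>M gauss_seq \<sigma>). \<not> (\<Sum>t\<in>{a..<a + m}. (snd p t)\<^sup>2) \<le> c}
    \<le> ennreal (exp (- c / (4 * \<sigma>\<^sup>2)) * sqrt 2 ^ m)" (is "emeasure ?P ?A \<le> _")
proof -
  have "emeasure ?P ?A \<le> (\<integral>\<^sup>+p. ennreal (exp (- c / (4 * \<sigma>\<^sup>2))) *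
      ennreal (exp ((\<Sum>t\<in>{a..<a + m}. (snd p t)\<^sup>2) / (4 * \<sigma>\<^sup>2))) \<partial>?P)"
  proof (rule emeasure_le_nn_integral)
    show "?A \<in> sets ?P" by measurable
    fix p assume "p \<in> ?A"
    then have "0 \<le> ((\<Sum>t\<in>{a..<a + m}. (snd p t)\<^sup>2) - c) / (4 * \<sigma>\<^sup>2)" by simp
    then have "1 \<le> exp (- c / (4 * \<sigma>\<^sup>2) + (\<Sum>t\<in>{a..<a + m}. (snd p t)\<^sup>2) / (4 * \<sigma>\<^sup>2))"
      by (simp add: diff_divide_distrib)
    then have "ennreal 1 \<le> ennreal (exp (- c / (4 * \<sigma>\<^sup>2)) * exp ((\<Sum>t\<in>{a..<a + m}. (snd p t)\<^sup>2) / (4 * \<sigma>\<^sup>2)))"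
      unfolding exp_add by (rule ennreal_leI)
    then show "1 \<le> ennreal (exp (- c / (4 * \<sigma>\<^sup>2))) * ennreal (exp ((\<Sum>t\<in>{a..<a + m}. (snd p t)\<^sup>2) / (4 * \<sigma>\<^sup>2)))"
      by (simp add: ennreal_mult)
  qed
  also have "\<dots> = ennreal (exp (- c / (4 * \<sigma>\<^sup>2))) *
      (\<integral>\<^sup>+p. ennreal (exp ((\<Sum>t\<in>{a..<a + m}. (snd p t)\<^sup>2) / (4 * \<sigma>\<^sup>2))) \<partial>?P)"
    by (intro nn_integral_cmult) measurable
  also have "\<dots> \<le> ennreal (exp (- c / (4 * \<sigma>\<^sup>2))) * ennreal (sqrt 2) ^ m"
    by (intro mult_left_mono squares_exp[OF \<sigma>]) auto
  also have "\<dots> = ennreal (exp (- c / (4 * \<sigma>\<^sup>2)) * sqrt 2 ^ m)"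
    by (simp add: ennreal_power ennreal_mult)
  finally show ?thesis .
qed

section \<open>Recurrence under the dither\<close>

text \<open>The integrand drops by \<open>c\<close> below its bound \<open>d\<close> on a set of
  probability at least \<open>p\<close>. The gain is first added on the left and subtracted only
  after the integral is known to be finite.\<close>

lemma (in prob_space) nn_integral_le_minus:
  fixes f :: "'a \<Rightarrow> real"
  assumes [measurable]: "f \<in> borel_measurable M" "A \<in> sets M"
    and f: "\<And>x. 0 \<le> f x" "\<And>x. f x + c * indicator A x \<le> d"
    and c: "c \<ge> 0" and p: "p \<ge> 0" "ennreal p \<le> emeasure M A"
  shows "(\<integral>\<^sup>+x. ennreal (f x) \<partial>M) \<le> ennreal (d - c * p)"
proof -
  have d: "d \<ge> 0"
  proof -
    obtain x where "x \<in> space M" using not_empty by blast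
    have "0 \<le> c * indicator A x" using c by simp
    then show ?thesis using f(1)[of x] f(2)[of x] by linarith
  qed
  have "(\<integral>\<^sup>+x. ennreal (f x) \<partial>M) + ennreal (c * p) \<le> (\<integral>\<^sup>+x. ennreal (f x) \<partial>M) + ennreal c * emeasure M A"
    using c p by (auto simp: ennreal_mult intro!: add_mono mult_left_mono)
  also have "\<dots> = (\<integral>\<^sup>+x. ennreal (f x) + ennreal c * indicator A x \<partial>M)"
    by (subst nn_integral_add) (auto simp: nn_integral_cmult)
  also have "\<dots> = (\<integral>\<^sup>+x. ennreal (f x + c * indicator A x) \<partial>M)"
    using c f(1) by (intro nn_integral_cong) (auto simp: indicator_def)
  also have "\<dots> \<le> (\<integral>\<^sup>+x. ennreal d \<partial>M)"
    by (intro nn_integral_mono ennreal_leI f(2))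
  also have "\<dots> = ennreal d" by (simp add: emeasure_space_1)
  finally have le: "(\<integral>\<^sup>+x. ennreal (f x) \<partial>M) + ennreal (c * p) \<le> ennreal d" .
  then have "(\<integral>\<^sup>+x. ennreal (f x) \<partial>M) \<le> ennreal d"
    by (rule order_trans[rotated]) simp
  then obtain I where I: "(\<integral>\<^sup>+x. ennreal (f x) \<partial>M) = ennreal I" "I \<ge> 0"
    by (cases "\<integral>\<^sup>+x. ennreal (f x) \<partial>M" rule: ennreal_cases) (auto simp: top_unique)
  with le have "I + c * p \<le> d" using c p d by (simp flip: ennreal_plus)
  then show ?thesis using I by (simp add: ennreal_leI)
qed

context adaptive_loop
begin

text \<open>Every bin contains an interval and lies in \<open>{-r..r}\<close>, so the shifted noise
  density is bounded below on it uniformly in \<open>m\<close>; the minimum is over finitely many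
  bins.\<close>

lemma bin_hit:
  obtains p where "0 < p" "p \<le> 1"
    and "\<And>B m. B \<in> \<B> \<Longrightarrow> \<bar>m\<bar> \<le> accuracy \<Longrightarrow> ennreal p \<le> emeasure (gauss \<sigma>) {z. m + z \<in> B}"
proof -
  have "\<exists>q>0. \<forall>m. \<bar>m\<bar> \<le> accuracy \<longrightarrow> ennreal q \<le> emeasure (gauss \<sigma>) {z. m + z \<in> B}" if B: "B \<in> \<B>" for B
  proof -
    have [measurable]: "B \<in> sets borel" using B by (rule borel_bins)
    obtain x e where "e > 0" "cball x e \<subseteq> B"
      using open_bins[OF B] nonempty_bins[OF B] by (metis ex_in_conv open_contains_cball)
    then have sub: "{x - e..x + e} \<subseteq> B" by (simp add: cball_eq_atLeastAtMost)
    define K where "K = exp (- (accuracy + r)\<^sup>2 / (2 * \<sigma>\<^sup>2)) / (sqrt (2 * pi) * \<sigma> * 1)"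
    have "K > 0" using \<sigma>_pos by (simp add: K_def)
    have "ennreal (2 * e) = emeasure lborel {x - e..x + e}" using \<open>e > 0\<close> by simp
    also have "\<dots> \<le> emeasure lborel B" by (intro emeasure_mono sub) simp
    finally have "ennreal (K * (2 * e)) \<le> ennreal K * emeasure lborel B"
      using \<open>K > 0\<close> \<open>e > 0\<close> by (auto simp: ennreal_mult intro!: mult_left_mono)
    also have "\<dots> \<le> emeasure (gauss \<sigma>) {z. m + 1 * z \<in> B}" if "\<bar>m\<bar> \<le> accuracy" for m
      unfolding K_def by (rule gauss_hits[OF \<sigma>_pos]) (use that bounded_bins[OF B] in auto)
    finally show ?thesis using \<open>K > 0\<close> \<open>e > 0\<close> by (intro exI[of _ "K * (2 * e)"]) auto
  qed
  then obtain q where q: "\<And>B. B \<in> \<B> \<Longrightarrow> q B > 0"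
    "\<And>B m. B \<in> \<B> \<Longrightarrow> \<bar>m\<bar> \<le> accuracy \<Longrightarrow> ennreal (q B) \<le> emeasure (gauss \<sigma>) {z. m + z \<in> B}"
    by metis
  define p where "p = Min (insert 1 (q ` \<B>))"
  show ?thesis
  proof (rule that[of p])
    show "0 < p" "p \<le> 1" unfolding p_def using finite_bins q(1) by auto
    fix B m assume B: "B \<in> \<B>" "\<bar>m\<bar> \<le> accuracy"
    have "p \<le> q B" unfolding p_def using finite_bins B(1) by auto
    then show "ennreal p \<le> emeasure (gauss \<sigma>) {z. m + z \<in> B}"
      using q(2)[OF B] ennreal_leI order_trans by blast
  qed
qed

text \<open>The part of the zone in \<open>{-R..R}\<close> has measure at least
  \<open>c * R\<close>, while a dither of scale \<open>R\<close> has density of order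
  \<open>1 / R\<close> there. The product no longer depends on \<open>R\<close>; the noise is
  confined to \<open>{-1..1}\<close> at the price of a constant factor.\<close>

lemma zone_hit:
  obtains p where "0 < p"
    and "\<And>R m. 1 \<le> R \<Longrightarrow> l0 \<le> R \<Longrightarrow> \<bar>m\<bar> \<le> R \<Longrightarrow>
      ennreal p \<le> emeasure (gauss \<sigma> \<Otimes>\<^sub>M gauss \<sigma>) {q. norm (\<phi> (m + R * fst q + snd q)) \<le> L}"
proof -
  interpret G: prob_space "gauss \<sigma>" using \<sigma>_pos by (rule prob_space_gauss)
  interpret GG: pair_sigma_finite "gauss \<sigma>" "gauss \<sigma>" ..
  define Z where "Z = {x. norm (\<phi> x) \<le> L}"
  have [measurable]: "Z \<in> sets borel" unfolding Z_def by measurable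
  \<comment> \<open>The 3 arises from \<open>\<bar>m + z\<bar> + R \<le> 3 * R\<close>, valid for
    \<open>\<bar>m\<bar> \<le> R\<close> and \<open>\<bar>z\<bar> \<le> 1 \<le> R\<close>.\<close>
  define K where "K = exp (- 3\<^sup>2 / (2 * \<sigma>\<^sup>2)) / (sqrt (2 * pi) * \<sigma>)"
  have K: "K > 0" using \<sigma>_pos by (simp add: K_def)
  define K' where "K' = exp (- 1\<^sup>2 / (2 * \<sigma>\<^sup>2)) / (sqrt (2 * pi) * \<sigma> * 1) * 2"
  have K': "K' > 0" using \<sigma>_pos by (simp add: K'_def)
  have unit: "ennreal K' \<le> emeasure (gauss \<sigma>) {-1..1}"
  proof -
    have "ennreal K' = ennreal (K' / 2) * emeasure lborel {-1..1::real}"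
    proof -
      have "emeasure lborel {-1..1::real} = ennreal 2" by simp
      then show ?thesis using K' by (simp only: ennreal_mult[symmetric]) simp
    qed
    also have "\<dots> \<le> emeasure (gauss \<sigma>) {x. 0 + 1 * x \<in> {-1..1}}"
      using gauss_hits[OF \<sigma>_pos, of 1 "{-1..1}" 1 0 1] unfolding K'_def by simp
    also have "{x. 0 + 1 * x \<in> {-1..1::real}} = {-1..1}" by auto
    finally show ?thesis .
  qed
  have inner: "ennreal (K * c) \<le> emeasure (gauss \<sigma>) {x. (m + z) + R * x \<in> Z}"
    if R: "1 \<le> R" "l0 \<le> R" "\<bar>m\<bar> \<le> R" and z: "\<bar>z\<bar> \<le> 1" for R m z
  proof -
    have "K * c = K / R * (c * R)" using R by simp
    also have "ennreal \<dots> \<le> ennreal (K / R) * emeasure lborel (Z \<inter> {-R..R})"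
    proof -
      have "emeasure lborel (Z \<inter> {-R..R}) \<noteq> \<infinity>"
        using emeasure_mono[of "Z \<inter> {-R..R}" "{-R..R}" lborel] R by (auto simp: top_unique)
      then have "emeasure lborel (Z \<inter> {-R..R}) = ennreal (measure lborel (Z \<inter> {-R..R}))"
        by (simp add: emeasure_eq_ennreal_measure)
      moreover have "c * R \<le> measure lborel (Z \<inter> {-R..R})"
        unfolding Z_def by (rule density) (rule R)
      then have "K / R * (c * R) \<le> K / R * measure lborel (Z \<inter> {-R..R})"
        using K R by (intro mult_left_mono) auto
      then have "ennreal (K / R * (c * R)) \<le> ennreal (K / R) * ennreal (measure lborel (Z \<inter> {-R..R}))"
        using K R by (subst ennreal_mult[symmetric]) (auto intro: ennreal_leI)
      ultimately show ?thesis by (simp only:)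
    qed
    also have "\<dots> \<le> emeasure (gauss \<sigma>) {x. (m + z) + R * x \<in> Z \<inter> {-R..R}}"
      using gauss_hits[OF \<sigma>_pos, of R "Z \<inter> {-R..R}" R "m + z" 3] R z
      unfolding K_def by (auto simp: mult.commute)
    also have "\<dots> \<le> emeasure (gauss \<sigma>) {x. (m + z) + R * x \<in> Z}"
      by (intro emeasure_mono) auto
    finally show ?thesis .
  qed
  show ?thesis
  proof (rule that[of "K * c * K'"])
    show "0 < K * c * K'" using K K' c_pos by simp
    fix R m assume R: "1 \<le> R" "l0 \<le> R" "\<bar>m\<bar> \<le> R"
    have hit: "{q. m + R * fst q + snd q \<in> Z} \<in> sets (gauss \<sigma> \<Otimes>\<^sub>M gauss \<sigma>)"
    proof -
      have "{q \<in> space (gauss \<sigma> \<Otimes>\<^sub>M gauss \<sigma>). m + R * fst q + snd q \<in> Z} \<in> sets (gauss \<sigma> \<Otimes>\<^sub>M gauss \<sigma>)"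
        by measurable
      then show ?thesis by (simp add: space_pair_measure)
    qed
    have "ennreal (K * c * K') = ennreal (K * c) * ennreal K'"
      using K K' c_pos by (simp add: ennreal_mult)
    also have "\<dots> \<le> ennreal (K * c) * emeasure (gauss \<sigma>) {-1..1}"
      by (intro mult_left_mono unit) auto
    also have "\<dots> = (\<integral>\<^sup>+z. ennreal (K * c) * indicator {-1..1} z \<partial>gauss \<sigma>)"
      by (simp add: nn_integral_cmult)
    also have "\<dots> \<le> (\<integral>\<^sup>+z. emeasure (gauss \<sigma>) {x. (m + z) + R * x \<in> Z} \<partial>gauss \<sigma>)"
      using inner[OF R] by (intro nn_integral_mono) (auto simp: indicator_def)
    also have "\<dots> = emeasure (gauss \<sigma> \<Otimes>\<^sub>M gauss \<sigma>) {q. m + R * fst q + snd q \<in> Z}"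
      by (subst GG.emeasure_pair_measure_alt2[OF hit]) (auto intro!: nn_integral_cong arg_cong2[where f=emeasure] simp: ac_simps)
    finally show "ennreal (K * c * K') \<le> emeasure (gauss \<sigma> \<Otimes>\<^sub>M gauss \<sigma>) {q. norm (\<phi> (m + R * fst q + snd q)) \<le> L}"
      by (simp add: Z_def)
  qed
qed

definition weight :: "real \<Rightarrow> nat \<Rightarrow> nat \<Rightarrow> real \<Rightarrow> real" where
  "weight \<beta> k e y = (if norm (\<phi> y) \<le> radius k e then 1 else \<beta>)"

lemma measurable_weight [measurable]: "weight \<beta> k e \<in> borel_measurable borel"
  unfolding weight_def[abs_def] by measurable

text \<open>Outside the zone the dither leads back to it, and inside the zone the noise leads to \<open>B\<close>, in
  either case with a probability bounded below; a weight \<open>\<beta>\<close> slightly above \<open>1\<close> turns the two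
  possibilities into a geometric drift.\<close>

lemma drift:
  obtains \<beta> \<rho> k0 where "\<beta> \<ge> 1" "0 < \<rho>" "\<rho> < 1"
    and "\<And>k e y B. k \<ge> k0 \<Longrightarrow> accurate k e \<Longrightarrow> B \<in> \<B> \<Longrightarrow>
      (\<integral>\<^sup>+x. (\<integral>\<^sup>+z. ennreal (exp (- indicator B (\<theta> \<bullet> \<phi> y + control k e x y + z)) *
        weight \<beta> k e (\<theta> \<bullet> \<phi> y + control k e x y + z)) \<partial>gauss \<sigma>) \<partial>gauss \<sigma>)
      \<le> ennreal (\<rho> * weight \<beta> k e y)"
proof -
  interpret G: prob_space "gauss \<sigma>" using \<sigma>_pos by (rule prob_space_gauss)
  interpret GG: pair_prob_space "gauss \<sigma>" "gauss \<sigma>" ..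
  obtain p where p: "0 < p" "p \<le> 1"
    and bin: "\<And>B m. B \<in> \<B> \<Longrightarrow> \<bar>m\<bar> \<le> accuracy \<Longrightarrow> ennreal p \<le> emeasure (gauss \<sigma>) {z. m + z \<in> B}"
    by (rule bin_hit) blast
  obtain p' where p': "0 < p'"
    and zone: "\<And>R m. 1 \<le> R \<Longrightarrow> l0 \<le> R \<Longrightarrow> \<bar>m\<bar> \<le> R \<Longrightarrow>
      ennreal p' \<le> emeasure (gauss \<sigma> \<Otimes>\<^sub>M gauss \<sigma>) {q. norm (\<phi> (m + R * fst q + snd q)) \<le> L}"
    by (rule zone_hit) blast
  \<comment> \<open>With \<open>\<beta> = 1 + x\<close> the bound inside the zone is
    \<open>\<beta> * (1 - x) = 1 - x\<^sup>2\<close>. Outside, reaching the zone lowers the weight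
    by \<open>\<beta> - 1 = x\<close>, which leaves \<open>\<beta> - x * p'\<close>.\<close>
  define x where "x = (1 - exp (- 1)) * p"
  have x: "0 < x" "x < 1"
  proof -
    have e: "exp (- 1 :: real) < 1" "exp (- 1 :: real) > 0" by simp_all
    then show "0 < x" unfolding x_def using p by simp
    have "x \<le> (1 - exp (- 1)) * 1" unfolding x_def using e p by (intro mult_left_mono) auto
    also have "\<dots> < 1" by simp
    finally show "x < 1" .
  qed
  define \<beta> where "\<beta> = 1 + x"
  define \<rho> where "\<rho> = max (1 - x\<^sup>2) (1 - x * p' / \<beta>)"
  have \<beta>: "\<beta> > 1" using x by (simp add: \<beta>_def)
  have "x\<^sup>2 < 1" "0 < x\<^sup>2" "0 < x * p' / \<beta>"
    using x p' \<beta> power_strict_mono[of x 1 2] by simp_all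
  then have \<rho>: "0 < \<rho>" "\<rho> < 1" unfolding \<rho>_def by linarith+
  \<comment> \<open>From here on the dither scale \<open>real k * (1 + norm (\<phi> y))\<close> is
    at least 1, \<open>l0\<close> and \<open>\<bar>\<theta> \<bullet> \<phi> y\<bar>\<close>, as
    \<open>zone_hit\<close> demands.\<close>
  define k0 where "k0 = nat \<lceil>max (max 1 l0) (norm \<theta>)\<rceil>"
  show ?thesis
  proof (rule that[of \<beta> \<rho> k0])
    fix k e y B assume k: "k \<ge> k0" and acc: "accurate k e" and B: "B \<in> \<B>"
    have [measurable]: "B \<in> sets borel" using B by (rule borel_bins)
    have weight: "0 \<le> weight \<beta> k e y'" "weight \<beta> k e y' \<le> \<beta>" for y'
      using \<beta> by (auto simp: weight_def)
    define f where "f y' = exp (- indicat_real B y') * weight \<beta> k e y'" for y'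
    have [measurable]: "f \<in> borel_measurable borel" unfolding f_def[abs_def] by measurable
    have f0: "0 \<le> f y'" for y' using weight by (simp add: f_def)
    show "(\<integral>\<^sup>+x. (\<integral>\<^sup>+z. ennreal (exp (- indicator B (\<theta> \<bullet> \<phi> y + control k e x y + z)) *
        weight \<beta> k e (\<theta> \<bullet> \<phi> y + control k e x y + z)) \<partial>gauss \<sigma>) \<partial>gauss \<sigma>)
      \<le> ennreal (\<rho> * weight \<beta> k e y)"
    proof (cases "norm (\<phi> y) \<le> radius k e")
      case True
      define m where "m = (\<theta> - estimate e) \<bullet> \<phi> y"
      have m: "\<theta> \<bullet> \<phi> y + control k e x y = m" for x
        using True by (simp add: control_def m_def inner_diff_left)
      have "\<bar>m\<bar> \<le> norm (\<theta> - estimate e) * radius k e"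
        unfolding m_def by (rule order_trans[OF Cauchy_Schwarz_ineq2]) (use True in \<open>auto intro: mult_left_mono\<close>)
      also have "\<dots> \<le> accuracy" using acc by (simp add: accurate_def)
      finally have m_le: "\<bar>m\<bar> \<le> accuracy" .
      have "(\<integral>\<^sup>+z. ennreal (f (m + z)) \<partial>gauss \<sigma>) \<le> ennreal (\<beta> - \<beta> * (1 - exp (- 1)) * p)"
      proof (rule G.nn_integral_le_minus[where A = "{z. m + z \<in> B}"])
        show "{z. m + z \<in> B} \<in> sets (gauss \<sigma>)" by simp
        show "f (m + z) + \<beta> * (1 - exp (- 1)) * indicator {z. m + z \<in> B} z \<le> \<beta>" for z
          using mult_left_mono[OF weight(2)[of "m + z"], of "exp (- 1)"] weight(2)[of "m + z"]
          by (auto simp: f_def indicator_def algebra_simps)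
      qed (use f0 \<beta> p bin[OF B m_le] in auto)
      also have "\<beta> - \<beta> * (1 - exp (- 1)) * p = 1 - x\<^sup>2"
        by (simp add: \<beta>_def x_def power2_eq_square algebra_simps)
      also have "ennreal (1 - x\<^sup>2) \<le> ennreal (\<rho> * weight \<beta> k e y)"
        using True by (intro ennreal_leI) (simp add: \<rho>_def weight_def)
      finally show ?thesis unfolding f_def[symmetric] m
        using \<sigma>_pos by simp
    next
      case False
      define R where "R = real k * (1 + norm (\<phi> y))"
      have k': "1 \<le> real k" "l0 \<le> real k" "norm \<theta> \<le> real k"
        using k unfolding k0_def by linarith+
      have kR: "real k \<le> R" unfolding R_def using k' by (simp add: mult_le_cancel_left1)
      have "\<bar>\<theta> \<bullet> \<phi> y\<bar> \<le> norm \<theta> * norm (\<phi> y)" by (rule Cauchy_Schwarz_ineq2)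
      also have "\<dots> \<le> R" unfolding R_def using k' by (intro mult_mono) auto
      finally have \<theta>R: "\<bar>\<theta> \<bullet> \<phi> y\<bar> \<le> R" .
      have u: "\<theta> \<bullet> \<phi> y + control k e x y + z = \<theta> \<bullet> \<phi> y + R * x + z" for x z
        using False by (simp add: control_def R_def)
      define A where "A = {q. norm (\<phi> (\<theta> \<bullet> \<phi> y + R * fst q + snd q)) \<le> L}"
      have A [measurable]: "A \<in> sets (gauss \<sigma> \<Otimes>\<^sub>M gauss \<sigma>)"
      proof -
        have "{q \<in> space (gauss \<sigma> \<Otimes>\<^sub>M gauss \<sigma>). norm (\<phi> (\<theta> \<bullet> \<phi> y + R * fst q + snd q)) \<le> L} \<in> sets (gauss \<sigma> \<Otimes>\<^sub>M gauss \<sigma>)"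
          by measurable
        then show ?thesis by (simp add: A_def space_pair_measure)
      qed
      have "(\<integral>\<^sup>+q. ennreal (f (\<theta> \<bullet> \<phi> y + R * fst q + snd q)) \<partial>(gauss \<sigma> \<Otimes>\<^sub>M gauss \<sigma>)) \<le> ennreal (\<beta> - x * p')"
      proof (rule GG.nn_integral_le_minus[where A = A])
        have f_le: "f y' \<le> weight \<beta> k e y'" for y'
          unfolding f_def using weight(1)[of y'] by (intro mult_left_le_one_le) auto
        show "f (\<theta> \<bullet> \<phi> y + R * fst q + snd q) + x * indicator A q \<le> \<beta>" for q
        proof (cases "q \<in> A")
          case True
          then have "weight \<beta> k e (\<theta> \<bullet> \<phi> y + R * fst q + snd q) = 1"
            using radius_ge[of k e] by (auto simp: weight_def A_def)
          then show ?thesis using f_le[of "\<theta> \<bullet> \<phi> y + R * fst q + snd q"] True by (simp add: \<beta>_def)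
        next
          case False
          then show ?thesis using f_le weight(2) order_trans by fastforce
        qed
        show "A \<in> sets (gauss \<sigma> \<Otimes>\<^sub>M gauss \<sigma>)" by (rule A)
        show "ennreal p' \<le> emeasure (gauss \<sigma> \<Otimes>\<^sub>M gauss \<sigma>) A"
          unfolding A_def by (rule zone) (use k' kR \<theta>R in auto)
      qed (use f0 x p' in auto)
      also have "\<beta> - x * p' \<le> \<rho> * weight \<beta> k e y"
      proof -
        have "(1 - x * p' / \<beta>) * \<beta> \<le> \<rho> * \<beta>" using \<beta> by (intro mult_right_mono) (auto simp: \<rho>_def)
        then show ?thesis using False \<beta> by (simp add: weight_def left_diff_distrib)
      qed
      finally have le: "(\<integral>\<^sup>+q. ennreal (f (\<theta> \<bullet> \<phi> y + R * fst q + snd q)) \<partial>(gauss \<sigma> \<Otimes>\<^sub>M gauss \<sigma>))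
        \<le> ennreal (\<rho> * weight \<beta> k e y)" by (simp add: ennreal_leI)
      have "(\<integral>\<^sup>+x. (\<integral>\<^sup>+z. ennreal (f (\<theta> \<bullet> \<phi> y + R * x + z)) \<partial>gauss \<sigma>) \<partial>gauss \<sigma>) =
        (\<integral>\<^sup>+q. ennreal (f (\<theta> \<bullet> \<phi> y + R * fst q + snd q)) \<partial>(gauss \<sigma> \<Otimes>\<^sub>M gauss \<sigma>))"
        by (subst G.nn_integral_fst[symmetric]) auto
      with le show ?thesis unfolding f_def[symmetric] u by simp
    qed
  qed (use \<beta> \<rho> in auto)
qed

end

section \<open>Almost sure behaviour for a fixed parameter\<close>

lemma window_eq: "window k = {32 ^ k..<32 ^ k + 31 * 32 ^ k}"
  by (simp add: window_def)

context adaptive_loop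
begin

abbreviation "GG \<equiv> gauss_seq \<sigma> \<Otimes>\<^sub>M gauss_seq \<sigma>"

lemma measurable_loop [measurable]:
  "(\<lambda>p. loop (fst p) (snd p) t) \<in> borel_measurable GG"
proof -
  have "(\<lambda>p. (\<theta>, fst p, snd p)) \<in> measurable GG (borel \<Otimes>\<^sub>M (real_seq \<Otimes>\<^sub>M real_seq))"
    by measurable
  from measurable_compose[OF this measurable_traj] show ?thesis by simp
qed

lemma measurable_code [measurable]:
  "(\<lambda>p. code k (fst p) (snd p)) \<in> measurable GG (count_space UNIV)"
proof -
  have "(\<lambda>p. loop (fst p) (snd p)) \<in> measurable GG real_seq"
    by (rule measurable_real_seqI) (rule measurable_loop)
  then have "(\<lambda>p. (fst p, loop (fst p) (snd p))) \<in> measurable GG (real_seq \<Otimes>\<^sub>M real_seq)"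
    by measurable
  from measurable_compose[OF this measurable_est] show ?thesis by simp
qed

lemma measurable_weight_code [measurable (raw)]:
  assumes [measurable]: "e \<in> measurable M (count_space UNIV)" "y \<in> borel_measurable M"
  shows "(\<lambda>\<omega>. weight \<beta> k (e \<omega>) (y \<omega>)) \<in> borel_measurable M"
  by (rule measurable_compose_countable[of "\<lambda>e \<omega>. weight \<beta> k e (y \<omega>)"]) simp_all

text \<open>A Chernoff bound from below: the expectation of \<open>exp (- visits)\<close> decays
  like \<open>\<rho>\<close> to the length of the window, whereas at most \<open>16 ^ k\<close>
  visits would keep this quantity above \<open>exp (- (16 ^ k))\<close>.\<close>

lemma visits_tail:
  obtains \<beta> \<rho> k0 where "0 < \<rho>" "\<rho> < 1" and "\<And>k B. k \<ge> k0 \<Longrightarrow> B \<in> \<B> \<Longrightarrow>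
    emeasure GG {p \<in> space GG. accurate k (code k (fst p) (snd p)) \<and> \<not> 16 ^ k \<le> visits k B (loop (fst p) (snd p))}
    \<le> ennreal (exp (16 ^ k + 1) * \<beta> * \<rho> ^ (31 * 32 ^ k))"
proof -
  obtain \<beta> \<rho> k0 where \<beta>: "\<beta> \<ge> 1" and \<rho>: "0 < \<rho>" "\<rho> < 1"
    and drift: "\<And>k e y B. k \<ge> k0 \<Longrightarrow> accurate k e \<Longrightarrow> B \<in> \<B> \<Longrightarrow>
      (\<integral>\<^sup>+x. (\<integral>\<^sup>+z. ennreal (exp (- indicator B (\<theta> \<bullet> \<phi> y + control k e x y + z)) *
        weight \<beta> k e (\<theta> \<bullet> \<phi> y + control k e x y + z)) \<partial>gauss \<sigma>) \<partial>gauss \<sigma>)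
      \<le> ennreal (\<rho> * weight \<beta> k e y)"
    by (rule drift) blast
  have weight: "1 \<le> weight \<beta> k e y" "weight \<beta> k e y \<le> \<beta>" for k e y
    using \<beta> by (auto simp: weight_def)
  have weight0: "0 \<le> weight \<beta> k e y" for k e y
    using weight(1)[of k e y] by linarith
  interpret sequence_space "gauss \<sigma>" using \<sigma>_pos by (rule sequence_space_gauss)
  interpret Q: prob_space GG using \<sigma>_pos by (rule prob_space_gauss_pair)
  show ?thesis
  proof (rule that[OF \<rho>, of k0 \<beta>])
    fix k B assume k: "k \<ge> k0" and B: "B \<in> \<B>"
    have [measurable]: "B \<in> sets borel" using B by (rule borel_bins)
    define y :: "(nat \<Rightarrow> real) \<times> (nat \<Rightarrow> real) \<Rightarrow> nat \<Rightarrow> real"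
      where "y p = loop (fst p) (snd p)" for p
    define e :: "(nat \<Rightarrow> real) \<times> (nat \<Rightarrow> real) \<Rightarrow> nat" where "e p = code k (fst p) (snd p)" for p
    have [measurable]: "(\<lambda>p. y p t) \<in> borel_measurable GG" for t
      unfolding y_def by measurable
    have [measurable]: "e \<in> measurable GG (count_space UNIV)"
      unfolding e_def[abs_def] by measurable
    define N where "N t p = (\<Sum>i\<in>{32 ^ k..<t}. indicat_real B (y p i))" for t :: nat and p
    have [measurable]: "N t \<in> borel_measurable GG" for t
      unfolding N_def[abs_def] by measurable
    \<comment> \<open>The discount for the output at \<open>t\<close> itself is included here,
      because \<open>drift\<close> bounds discount and weight of the next output jointly;
      \<open>N t\<close> therefore stops before \<open>t\<close>.\<close>
    define w where "w p x = exp (- indicat_real B x) * weight \<beta> k (e p) x" for p x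
    \<comment> \<open>Setting \<open>V\<close> to zero for an inaccurate code restricts the estimate
      to an event decided before the epoch, without conditioning.\<close>
    define V where "V t p = (if accurate k (e p) then ennreal (exp (- N t p)) * ennreal (w p (y p t)) else 0)" for t p
    define next_y where "next_y t q =
      \<theta> \<bullet> \<phi> (y (fst q) t) + control k (e (fst q)) (fst (snd q)) (y (fst q) t) + snd (snd q)"
      for t and q :: "((nat \<Rightarrow> real) \<times> (nat \<Rightarrow> real)) \<times> (real \<times> real)"
    define g where "g t q = (if accurate k (e (fst q)) then ennreal (exp (- N (Suc t) (fst q))) * ennreal (w (fst q) (next_y t q)) else 0)" for t q
    have "(\<integral>\<^sup>+p. V (32 ^ k + 31 * 32 ^ k) p \<partial>GG) \<le> ennreal \<rho> ^ (31 * 32 ^ k) * (\<integral>\<^sup>+p. V (32 ^ k) p \<partial>GG)"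
    proof (rule nn_integral_geometric[where g = g])
      show "V t \<in> borel_measurable GG" for t
        unfolding V_def[abs_def] w_def by measurable
      show "g t \<in> borel_measurable (GG \<Otimes>\<^sub>M (gauss \<sigma> \<Otimes>\<^sub>M gauss \<sigma>))" for t
        unfolding g_def[abs_def] w_def next_y_def by measurable
    next
      fix t :: nat and \<xi> \<xi>' \<eta> \<eta>' :: "nat \<Rightarrow> real" and z :: "real \<times> real"
      assume t: "32 ^ k \<le> t" and eq: "\<And>i. i < t \<Longrightarrow> \<xi> i = \<xi>' i" "\<And>i. i < t \<Longrightarrow> \<eta> i = \<eta>' i"
      have y_eq: "y (\<xi>, \<eta>) i = y (\<xi>', \<eta>') i" if "i \<le> t" for i
        unfolding y_def fst_conv snd_conv by (rule traj_past[of t]) (use eq that in auto)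
      have e_eq: "e (\<xi>, \<eta>) = e (\<xi>', \<eta>')"
        unfolding e_def fst_conv snd_conv by (rule est_past[of t]) (use eq t in auto)
      have "N (Suc t) (\<xi>, \<eta>) = N (Suc t) (\<xi>', \<eta>')"
        unfolding N_def by (intro sum.cong) (auto simp: y_eq)
      then show "g t ((\<xi>, \<eta>), z) = g t ((\<xi>', \<eta>'), z)"
        using y_eq[of t] e_eq by (simp add: g_def w_def next_y_def)
    next
      fix t :: nat and p assume t: "32 ^ k \<le> t" "t < 32 ^ k + 31 * 32 ^ k"
      have "y p (Suc t) = next_y t (p, fst p t, snd p t)"
        unfolding y_def next_y_def e_def using t by (simp add: traj_Suc_window[of t k] window_eq)
      then show "V (Suc t) p = g t (p, fst p t, snd p t)"
        by (simp add: V_def g_def)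
    next
      fix t :: nat and p assume t: "32 ^ k \<le> t"
      show "(\<integral>\<^sup>+x. (\<integral>\<^sup>+z. g t (p, x, z) \<partial>gauss \<sigma>) \<partial>gauss \<sigma>) \<le> ennreal \<rho> * V t p"
      proof (cases "accurate k (e p)")
        case True
        have "(\<integral>\<^sup>+x. (\<integral>\<^sup>+z. g t (p, x, z) \<partial>gauss \<sigma>) \<partial>gauss \<sigma>) = ennreal (exp (- N (Suc t) p)) *
          (\<integral>\<^sup>+x. (\<integral>\<^sup>+z. ennreal (w p (next_y t (p, x, z))) \<partial>gauss \<sigma>) \<partial>gauss \<sigma>)"
          using True unfolding g_def w_def next_y_def
          by (simp add: nn_integral_cmult)
        also have "\<dots> \<le> ennreal (exp (- N (Suc t) p)) * ennreal (\<rho> * weight \<beta> k (e p) (y p t))"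
          unfolding w_def next_y_def fst_conv snd_conv
          by (intro mult_left_mono drift k True B) auto
        also have "\<dots> = ennreal \<rho> * (ennreal (exp (- N t p)) * ennreal (w p (y p t)))"
        proof -
          have "exp (- N (Suc t) p) = exp (- N t p) * exp (- indicat_real B (y p t))"
            using t by (simp add: N_def sum.atLeastLessThan_Suc flip: exp_add)
          then show ?thesis using \<rho> weight0 by (simp add: w_def ac_simps flip: ennreal_mult)
        qed
        finally show ?thesis using True by (simp add: V_def)
      qed (simp add: g_def)
    qed
    also have "\<dots> \<le> ennreal \<rho> ^ (31 * 32 ^ k) * ennreal \<beta>"
    proof -
      have "V (32 ^ k) p \<le> ennreal \<beta>" for p
      proof -
        have "w p (y p (32 ^ k)) \<le> weight \<beta> k (e p) (y p (32 ^ k))"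
          unfolding w_def using weight0 by (intro mult_left_le_one_le) auto
        then have "w p (y p (32 ^ k)) \<le> \<beta>" using weight(2) order_trans by blast
        then show ?thesis by (simp add: V_def N_def ennreal_leI)
      qed
      then have "(\<integral>\<^sup>+p. V (32 ^ k) p \<partial>GG) \<le> (\<integral>\<^sup>+p. ennreal \<beta> \<partial>GG)" by (intro nn_integral_mono)
      then show ?thesis by (intro mult_left_mono) (simp_all add: Q.emeasure_space_1)
    qed
    finally have E: "(\<integral>\<^sup>+p. V (32 ^ k + 31 * 32 ^ k) p \<partial>GG) \<le> ennreal \<rho> ^ (31 * 32 ^ k) * ennreal \<beta>" .
    let ?A = "{p \<in> space GG. accurate k (code k (fst p) (snd p)) \<and> \<not> 16 ^ k \<le> visits k B (loop (fst p) (snd p))}"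
    have "emeasure GG ?A \<le> (\<integral>\<^sup>+p. ennreal (exp (16 ^ k + 1)) * V (32 ^ k + 31 * 32 ^ k) p \<partial>GG)"
    proof (rule emeasure_le_nn_integral)
      have A: "?A = {p \<in> space GG. accurate k (e p) \<and> \<not> 16 ^ k \<le> N (32 ^ k + 31 * 32 ^ k) p}"
        by (simp add: e_def N_def y_def visits_def window_eq)
      show "?A \<in> sets GG" unfolding A by measurable
      fix p assume "p \<in> ?A"
      then have p: "accurate k (e p)" "N (32 ^ k + 31 * 32 ^ k) p \<le> 16 ^ k" unfolding A by auto
      \<comment> \<open>The first output after the window is also discounted; this factor accounts
        for the \<open>+ 1\<close> in the bound.\<close>
      have "exp (- 1) * 1 \<le> w p (y p (32 ^ k + 31 * 32 ^ k))"
        unfolding w_def using weight by (intro mult_mono) (auto simp: indicator_def)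
      then have "exp (16 ^ k + 1) * (exp (- (16 ^ k)) * exp (- 1)) \<le>
          exp (16 ^ k + 1) * (exp (- N (32 ^ k + 31 * 32 ^ k) p) * w p (y p (32 ^ k + 31 * 32 ^ k)))"
        using p(2) by (intro mult_left_mono mult_mono) auto
      also have "exp (16 ^ k + 1) * (exp (- (16 ^ k)) * exp (- 1)) = (1 :: real)"
        by (simp flip: exp_add)
      finally have "ennreal 1 \<le> ennreal (exp (16 ^ k + 1) * (exp (- N (32 ^ k + 31 * 32 ^ k) p) * w p (y p (32 ^ k + 31 * 32 ^ k))))"
        by (rule ennreal_leI)
      then show "1 \<le> ennreal (exp (16 ^ k + 1)) * V (32 ^ k + 31 * 32 ^ k) p"
        using p(1) weight0 by (simp add: V_def w_def ennreal_mult)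
    qed
    also have "\<dots> = ennreal (exp (16 ^ k + 1)) * (\<integral>\<^sup>+p. V (32 ^ k + 31 * 32 ^ k) p \<partial>GG)"
      unfolding V_def w_def by (rule nn_integral_cmult) measurable
    also have "\<dots> \<le> ennreal (exp (16 ^ k + 1)) * (ennreal \<rho> ^ (31 * 32 ^ k) * ennreal \<beta>)"
      by (intro mult_left_mono E) auto
    also have "\<dots> = ennreal (exp (16 ^ k + 1) * \<beta> * \<rho> ^ (31 * 32 ^ k))"
      using \<rho> \<beta> by (simp add: ennreal_power ac_simps flip: ennreal_mult)
    finally show "emeasure GG ?A \<le> ennreal (exp (16 ^ k + 1) * \<beta> * \<rho> ^ (31 * 32 ^ k))" .
  qed
qed

text \<open>The bound is summable because \<open>16 ^ k\<close> is negligible against the window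
  length \<open>31 * 32 ^ k\<close>.\<close>

lemma AE_visits:
  "AE p in GG. eventually (\<lambda>k. accurate k (code k (fst p) (snd p)) \<longrightarrow>
    (\<forall>B\<in>\<B>. 16 ^ k \<le> visits k B (loop (fst p) (snd p)))) sequentially"
proof -
  interpret Q: prob_space GG using \<sigma>_pos by (rule prob_space_gauss_pair)
  obtain \<beta> \<rho> k0 where \<rho>: "0 < \<rho>" "\<rho> < 1" and tail: "\<And>k B. k \<ge> k0 \<Longrightarrow> B \<in> \<B> \<Longrightarrow>
    emeasure GG {p \<in> space GG. accurate k (code k (fst p) (snd p)) \<and> \<not> 16 ^ k \<le> visits k B (loop (fst p) (snd p))}
    \<le> ennreal (exp (16 ^ k + 1) * \<beta> * \<rho> ^ (31 * 32 ^ k))"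
    by (rule visits_tail) blast
  define s where "s = - ln \<rho>"
  have s: "s > 0" "\<rho> = exp (- s)" using \<rho> by (auto simp: s_def)
  have bound: "eventually (\<lambda>k. exp (16 ^ k + 1) * \<beta> * \<rho> ^ (31 * 32 ^ k) \<le> (1 / 2) ^ k) sequentially"
  proof -
    have "eventually (\<lambda>k::nat. exp (16 ^ k + 1) * \<beta> * exp (- s * (31 * 32 ^ k)) \<le> (1 / 2) ^ k) sequentially"
      using s(1) by real_asymp
    moreover have "\<rho> ^ (31 * 32 ^ k) = exp (- s * (31 * 32 ^ k))" for k
      unfolding s(2) by (simp flip: exp_of_nat_mult)
    ultimately show ?thesis by simp
  qed
  have "AE p in GG. eventually (\<lambda>k. accurate k (code k (fst p) (snd p)) \<longrightarrow>
      16 ^ k \<le> visits k B (loop (fst p) (snd p))) sequentially" if B: "B \<in> \<B>" for B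
  proof -
    have [measurable]: "B \<in> sets borel" using B by (rule borel_bins)
    have "AE p in GG. eventually (\<lambda>k. p \<notin> {p \<in> space GG. accurate k (code k (fst p) (snd p)) \<and>
        \<not> 16 ^ k \<le> visits k B (loop (fst p) (snd p))}) sequentially"
    proof (rule Q.AE_eventually_notin[OF _ _ bound])
      show "eventually (\<lambda>k. emeasure GG {p \<in> space GG. accurate k (code k (fst p) (snd p)) \<and> \<not> 16 ^ k \<le> visits k B (loop (fst p) (snd p))}
        \<le> ennreal (exp (16 ^ k + 1) * \<beta> * \<rho> ^ (31 * 32 ^ k))) sequentially"
        using eventually_ge_at_top[of k0] by eventually_elim (rule tail[OF _ B])
    qed (unfold visits_def, measurable)
    then show ?thesis using AE_space
      by eventually_elim (auto elim: eventually_mono)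
  qed
  then have "AE p in GG. \<forall>B\<in>\<B>. eventually (\<lambda>k. accurate k (code k (fst p) (snd p)) \<longrightarrow>
      16 ^ k \<le> visits k B (loop (fst p) (snd p))) sequentially"
    by (intro AE_finite_allI finite_bins)
  then show ?thesis
  proof eventually_elim
    case (elim p)
    then show ?case
      by (subst (asm) eventually_ball_finite_distrib[symmetric]) (auto simp: finite_bins elim: eventually_mono)
  qed
qed

text \<open>The Chernoff parameter is \<open>1 / 6 ^ k\<close>, where 6 lies between the square root
  of 32 and 8: the linear term \<open>(8 / 6) ^ k\<close> tends to infinity and the quadratic one,
  of order \<open>(32 / 36) ^ k\<close>, to zero.\<close>

lemma AE_noise:
  "AE p in GG. eventually (\<lambda>k. \<forall>B\<in>\<B>.
    \<bar>\<Sum>t\<in>window k. indicator B (loop (fst p) (snd p) t) * snd p t\<bar> \<le> 8 ^ k) sequentially"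
proof -
  interpret Q: prob_space GG using \<sigma>_pos by (rule prob_space_gauss_pair)
  have "AE p in GG. eventually (\<lambda>k.
    \<bar>\<Sum>t\<in>window k. indicator B (loop (fst p) (snd p) t) * snd p t\<bar> \<le> 8 ^ k) sequentially" if B: "B \<in> \<B>" for B
  proof -
    have [measurable]: "B \<in> sets borel" using B by (rule borel_bins)
    have "AE p in GG. eventually (\<lambda>k. p \<notin> {p \<in> space GG.
       \<not> \<bar>\<Sum>t\<in>window k. indicator B (loop (fst p) (snd p) t) * snd p t\<bar> \<le> 8 ^ k}) sequentially"
    proof (rule Q.AE_eventually_notin)
      show "{p \<in> space GG. \<not> \<bar>\<Sum>t\<in>window k. indicator B (loop (fst p) (snd p) t) * snd p t\<bar> \<le> 8 ^ k} \<in> sets GG" for k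
        by measurable
      have tail: "emeasure GG {p \<in> space GG. \<not> \<bar>\<Sum>t\<in>window k. indicator B (loop (fst p) (snd p) t) * snd p t\<bar> \<le> 8 ^ k}
        \<le> ennreal (2 * exp (- (1 / 6 ^ k) * 8 ^ k + real (31 * 32 ^ k) * ((1 / 6 ^ k)\<^sup>2 * \<sigma>\<^sup>2 / 2)))" for k
        unfolding window_eq
      proof (rule noise_sum_tail[OF \<sigma>_pos])
        fix t :: nat and \<xi> \<xi>' \<eta> \<eta>' :: "nat \<Rightarrow> real"
        assume eq: "\<And>i. i < t \<Longrightarrow> \<xi> i = \<xi>' i" "\<And>i. i < t \<Longrightarrow> \<eta> i = \<eta>' i"
        have "loop \<xi> \<eta> t = loop \<xi>' \<eta>' t" by (rule traj_past[of t]) (use eq in auto)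
        then show "indicat_real B (loop (fst (\<xi>, \<eta>)) (snd (\<xi>, \<eta>)) t) = indicat_real B (loop (fst (\<xi>', \<eta>')) (snd (\<xi>', \<eta>')) t)"
          by simp
      qed (auto simp: indicator_def)
      have eq: "- (1 / 6 ^ k) * 8 ^ k + real (31 * 32 ^ k) * ((1 / 6 ^ k)\<^sup>2 * \<sigma>\<^sup>2 / 2)
          = - ((4 / 3) ^ k) + 31 * (\<sigma>\<^sup>2 / 2) * (8 / 9) ^ k" for k
      proof -
        have "(6 ^ k)\<^sup>2 = (36 :: real) ^ k"
          by (simp add: power2_eq_square flip: power_mult_distrib)
        then have "(8 :: real) ^ k = 6 ^ k * (4 / 3) ^ k" "(32 :: real) ^ k = (6 ^ k)\<^sup>2 * (8 / 9) ^ k"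
          by (simp_all flip: power_mult_distrib)
        then show ?thesis by (simp add: power2_eq_square del: power_mult_distrib)
      qed
      show "eventually (\<lambda>k. emeasure GG {p \<in> space GG.
          \<not> \<bar>\<Sum>t\<in>window k. indicator B (loop (fst p) (snd p) t) * snd p t\<bar> \<le> 8 ^ k}
        \<le> ennreal (2 * exp (- ((4 / 3) ^ k) + 31 * (\<sigma>\<^sup>2 / 2) * (8 / 9) ^ k))) sequentially"
        using tail unfolding eq by (intro always_eventually allI)
      show "eventually (\<lambda>k. 2 * exp (- ((4 / 3) ^ k) + 31 * (\<sigma>\<^sup>2 / 2) * (8 / 9) ^ k) \<le> (1 / 2) ^ k) sequentially"
        by real_asymp
    qed
    then show ?thesis using AE_space
      by eventually_elim (auto elim: eventually_mono)
  qed
  then have "AE p in GG. \<forall>B\<in>\<B>. eventually (\<lambda>k.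
    \<bar>\<Sum>t\<in>window k. indicator B (loop (fst p) (snd p) t) * snd p t\<bar> \<le> 8 ^ k) sequentially"
    by (intro AE_finite_allI finite_bins)
  then show ?thesis
    by eventually_elim (simp add: eventually_ball_finite_distrib finite_bins)
qed

text \<open>A union bound: a single tail is of order \<open>exp (- a * (real k)\<^sup>2)\<close>,
  which beats the exponential number of times in the window.\<close>

lemma AE_tails:
  "AE p in GG. eventually (\<lambda>k. \<forall>t\<in>window k. \<bar>snd p t\<bar> \<le> real k / (4 * k2)) sequentially"
proof -
  interpret Q: prob_space GG using \<sigma>_pos by (rule prob_space_gauss_pair)
  define a where "a = 1 / (4 * \<sigma>\<^sup>2) / (4 * k2)\<^sup>2"
  have a: "a > 0" using \<sigma>_pos k2_pos by (simp add: a_def)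
  have single: "emeasure GG {p \<in> space GG. \<not> \<bar>snd p t\<bar> \<le> real k / (4 * k2)} \<le> ennreal (exp (- a * (real k)\<^sup>2) * sqrt 2)" for t k
  proof -
    have "{p \<in> space GG. \<not> \<bar>snd p t\<bar> \<le> real k / (4 * k2)} =
      {p \<in> space GG. \<not> (\<Sum>t\<in>{t..<t + 1}. (snd p t)\<^sup>2) \<le> (real k / (4 * k2))\<^sup>2}"
      using k2_pos by (simp add: abs_le_square_iff[symmetric])
    then have "emeasure GG {p \<in> space GG. \<not> \<bar>snd p t\<bar> \<le> real k / (4 * k2)} \<le>
        ennreal (exp (- (real k / (4 * k2))\<^sup>2 / (4 * \<sigma>\<^sup>2)) * sqrt 2 ^ 1)"
      using squares_tail[OF \<sigma>_pos, of t 1 "(real k / (4 * k2))\<^sup>2"] by (simp only:)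
    also have "- (real k / (4 * k2))\<^sup>2 / (4 * \<sigma>\<^sup>2) = - a * (real k)\<^sup>2"
      by (simp add: a_def power_divide)
    finally show ?thesis by simp
  qed
  have "AE p in GG. eventually (\<lambda>k. p \<notin> {p \<in> space GG. \<not> (\<forall>t\<in>window k. \<bar>snd p t\<bar> \<le> real k / (4 * k2))}) sequentially"
  proof (rule Q.AE_eventually_notin)
    show "{p \<in> space GG. \<not> (\<forall>t\<in>window k. \<bar>snd p t\<bar> \<le> real k / (4 * k2))} \<in> sets GG" for k
      by measurable
    have "emeasure GG {p \<in> space GG. \<not> (\<forall>t\<in>window k. \<bar>snd p t\<bar> \<le> real k / (4 * k2))}
      \<le> ennreal (31 * 32 ^ k * (exp (- a * (real k)\<^sup>2) * sqrt 2))" for k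
    proof -
      have "{p \<in> space GG. \<not> (\<forall>t\<in>window k. \<bar>snd p t\<bar> \<le> real k / (4 * k2))} =
          (\<Union>t\<in>window k. {p \<in> space GG. \<not> \<bar>snd p t\<bar> \<le> real k / (4 * k2)})" by auto
      also have "emeasure GG \<dots> \<le> (\<Sum>t\<in>window k. emeasure GG {p \<in> space GG. \<not> \<bar>snd p t\<bar> \<le> real k / (4 * k2)})"
        by (intro emeasure_subadditive_finite) auto
      also have "\<dots> \<le> (\<Sum>t\<in>window k. ennreal (exp (- a * (real k)\<^sup>2) * sqrt 2))"
        by (intro sum_mono single)
      also have "\<dots> = ennreal (31 * 32 ^ k * (exp (- a * (real k)\<^sup>2) * sqrt 2))"
        by (subst sum_ennreal) (simp_all add: card_window)
      finally show ?thesis .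
    qed
    then show "eventually (\<lambda>k. emeasure GG {p \<in> space GG. \<not> (\<forall>t\<in>window k. \<bar>snd p t\<bar> \<le> real k / (4 * k2))}
      \<le> ennreal (31 * 32 ^ k * (exp (- a * (real k)\<^sup>2) * sqrt 2))) sequentially"
      by (intro always_eventually allI)
    show "eventually (\<lambda>k::nat. 31 * 32 ^ k * (exp (- a * (real k)\<^sup>2) * sqrt 2) \<le> (1 / 2) ^ k) sequentially"
      using a by real_asymp
  qed
  then show ?thesis using AE_space by eventually_elim (auto elim: eventually_mono)
qed

text \<open>The constant 8 makes the Chernoff bound \<open>(exp (- 2) * sqrt 2) ^ t\<close>, which
  is at most \<open>(1 / 2) ^ t\<close>.\<close>

lemma AE_squares:
  "AE p in GG. eventually (\<lambda>t. (\<Sum>i<t. (snd p i)\<^sup>2) \<le> 8 * \<sigma>\<^sup>2 * real t) sequentially"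
proof -
  interpret Q: prob_space GG using \<sigma>_pos by (rule prob_space_gauss_pair)
  have "AE p in GG. eventually (\<lambda>t. p \<notin> {p \<in> space GG. \<not> (\<Sum>i\<in>{0..<0 + t}. (snd p i)\<^sup>2) \<le> 8 * \<sigma>\<^sup>2 * real t}) sequentially"
  proof (rule Q.AE_eventually_notin)
    show "{p \<in> space GG. \<not> (\<Sum>i\<in>{0..<0 + t}. (snd p i)\<^sup>2) \<le> 8 * \<sigma>\<^sup>2 * real t} \<in> sets GG" for t
      by measurable
    have "emeasure GG {p \<in> space GG. \<not> (\<Sum>i\<in>{0..<0 + t}. (snd p i)\<^sup>2) \<le> 8 * \<sigma>\<^sup>2 * real t} \<le>
      ennreal (exp (- 2 * real t) * sqrt 2 ^ t)" for t
      using squares_tail[OF \<sigma>_pos, of 0 t "8 * \<sigma>\<^sup>2 * real t"] \<sigma>_pos by simp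
    then show "eventually (\<lambda>t. emeasure GG {p \<in> space GG. \<not> (\<Sum>i\<in>{0..<0 + t}. (snd p i)\<^sup>2) \<le> 8 * \<sigma>\<^sup>2 * real t} \<le>
      ennreal (exp (- 2 * real t) * sqrt 2 ^ t)) sequentially"
      by (intro always_eventually allI)
    have "exp (- 2) * sqrt 2 \<le> 1 / 2"
    proof -
      have "sqrt 2 \<le> 3 / 2" by (rule real_le_lsqrt) (simp_all add: power2_eq_square)
      moreover have "3 \<le> exp (2 :: real)" using exp_ge_add_one_self[of "2 :: real"] by simp
      ultimately have "2 * sqrt 2 \<le> exp 2" by linarith
      then show ?thesis by (simp add: exp_minus field_simps)
    qed
    then have "(exp (- 2) * sqrt 2) ^ t \<le> (1 / 2) ^ t" for t by (intro power_mono) auto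
    moreover have "exp (- 2 * real t) * sqrt 2 ^ t = (exp (- 2) * sqrt 2) ^ t" for t
      by (simp add: power_mult_distrib mult.commute flip: exp_of_nat_mult)
    ultimately show "eventually (\<lambda>t::nat. exp (- 2 * real t) * sqrt 2 ^ t \<le> (1 / 2) ^ t) sequentially"
      by (intro always_eventually allI) metis
  qed
  then show ?thesis using AE_space
    by eventually_elim (auto elim: eventually_mono simp: atLeast0LessThan)
qed

lemma AE_loop_stable:
  "AE p in GG. \<exists>K. \<forall>t\<ge>1. (\<Sum>i=1..t. (loop (fst p) (snd p) i)\<^sup>2) \<le> K * real t"
  using AE_noise AE_tails AE_visits AE_squares
  by eventually_elim (rule loop_stable)

end

section \<open>Derandomisation\<close>

lemma AE_gauss_iff:
  assumes "\<sigma> > 0"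
  shows "(AE x in gauss \<sigma>. P x) \<longleftrightarrow> (AE x in lborel. P x)"
  unfolding gauss_def using normal_density_pos[OF assms] by (subst AE_density) auto

lemma AE_lborel_shift:
  fixes c :: real
  assumes "AE x in lborel. P x"
  shows "AE x in lborel. P (c + x)"
proof -
  have "AE x in distr lborel borel ((+) c). P x"
    unfolding lborel_distr_plus by (rule assms)
  from AE_distrD[OF _ this] show ?thesis by simp
qed

text \<open>Gaussian and Lebesgue measure on the line have the same null sets, and the latter is
  translation invariant. \<open>PiM_iter\<close> splits off coordinate 0, so that only this factor
  is moved.\<close>

lemma AE_gauss_seq_shift:
  assumes \<sigma>: "\<sigma> > 0" and P [measurable]: "Measurable.pred real_seq P"
    and AE: "AE \<eta> in gauss_seq \<sigma>. P \<eta>"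
  shows "AE \<eta> in gauss_seq \<sigma>. P (\<eta>(0 := \<eta> 0 + c))"
proof -
  interpret sequence_space "gauss \<sigma>" using \<sigma> by (rule sequence_space_gauss)
  interpret MS: pair_sigma_finite "gauss \<sigma>" "gauss_seq \<sigma>" ..
  have iter: "distr (gauss \<sigma> \<Otimes>\<^sub>M gauss_seq \<sigma>) (gauss_seq \<sigma>) (\<lambda>(s, \<omega>). case_nat s \<omega>) = gauss_seq \<sigma>"
    by (rule PiM_iter)
  have case_nat_meas: "(\<lambda>(s, \<omega>). case_nat s \<omega>) \<in> measurable (gauss \<sigma> \<Otimes>\<^sub>M gauss_seq \<sigma>) (gauss_seq \<sigma>)"
    by measurable
  have shift [measurable]: "(\<lambda>\<eta>. \<eta>(0 := \<eta> 0 + c)) \<in> measurable real_seq real_seq"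
  proof (rule measurable_real_seqI)
    show "(\<lambda>\<eta>. (\<eta>(0 := \<eta> 0 + c)) i) \<in> borel_measurable real_seq" for i by (cases "i = 0") simp_all
  qed
  have "AE q in gauss \<sigma> \<Otimes>\<^sub>M gauss_seq \<sigma>. P (case q of (s, \<omega>) \<Rightarrow> case_nat s \<omega>)"
    by (rule AE_distrD[OF case_nat_meas]) (simp only: iter AE)
  then have "AE a in gauss \<sigma>. AE \<omega> in gauss_seq \<sigma>. P (case_nat a \<omega>)"
    using MS.AE_pair by fastforce
  then have "AE a in gauss \<sigma>. AE \<omega> in gauss_seq \<sigma>. P (case_nat (c + a) \<omega>)"
    unfolding AE_gauss_iff[OF \<sigma>] by (rule AE_lborel_shift)
  then have "AE q in gauss \<sigma> \<Otimes>\<^sub>M gauss_seq \<sigma>. P (case_nat (c + fst q) (snd q))"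
  proof (intro MS.AE_pair_measure)
    have "(\<lambda>q. case_nat (c + fst q) (snd q)) \<in> measurable (gauss \<sigma> \<Otimes>\<^sub>M gauss_seq \<sigma>) real_seq"
    proof (rule measurable_real_seqI)
      show "(\<lambda>q. case_nat (c + fst q) (snd q) i) \<in> borel_measurable (gauss \<sigma> \<Otimes>\<^sub>M gauss_seq \<sigma>)" for i
        by (cases i) simp_all
    qed
    from measurable_compose[OF this assms(2)]
    show "{q \<in> space (gauss \<sigma> \<Otimes>\<^sub>M gauss_seq \<sigma>). P (case_nat (c + fst q) (snd q))} \<in> sets (gauss \<sigma> \<Otimes>\<^sub>M gauss_seq \<sigma>)"
      by (simp only: pred_def)
  qed (simp only: fst_conv snd_conv)
  moreover have "case_nat (c + a) \<omega> = (case_nat a \<omega>)(0 := (case_nat a \<omega> 0) + c)" for a :: real and \<omega>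
    by (auto simp: fun_eq_iff split: nat.split)
  ultimately have *: "AE q in gauss \<sigma> \<Otimes>\<^sub>M gauss_seq \<sigma>. P ((case q of (s, \<omega>) \<Rightarrow> case_nat s \<omega>)
      (0 := (case q of (s, \<omega>) \<Rightarrow> case_nat s \<omega>) 0 + c))"
    by (simp add: case_prod_beta')
  have "AE \<eta> in distr (gauss \<sigma> \<Otimes>\<^sub>M gauss_seq \<sigma>) (gauss_seq \<sigma>) (\<lambda>(s, \<omega>). case_nat s \<omega>). P (\<eta>(0 := \<eta> 0 + c))"
    by (subst AE_distr_iff[OF case_nat_meas]) (use * in simp_all)
  then show ?thesis by (simp only: iter)
qed

text \<open>A natural bound makes the existential countable, hence the event measurable. The sum
  omits index 0, so the initial value matters only through later outputs.\<close>

definition stable :: "(nat \<Rightarrow> real) \<Rightarrow> bool" where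
  "stable y \<longleftrightarrow> (\<exists>K::nat. \<forall>t\<ge>1. (\<Sum>i=1..t. (y i)\<^sup>2) \<le> real K * real t)"

lemma stableI:
  assumes "\<And>t. t \<ge> 1 \<Longrightarrow> (\<Sum>i=1..t. (y i)\<^sup>2) \<le> K * real t"
  shows "stable y"
  unfolding stable_def
proof (intro exI[of _ "nat \<lceil>K\<rceil>"] allI impI)
  fix t :: nat assume "t \<ge> 1"
  have "K * real t \<le> real (nat \<lceil>K\<rceil>) * real t" by (intro mult_right_mono) linarith+
  then show "(\<Sum>i=1..t. (y i)\<^sup>2) \<le> real (nat \<lceil>K\<rceil>) * real t"
    using assms[OF \<open>t \<ge> 1\<close>] by linarith
qed

lemma stable_cong:
  assumes "\<And>i. i \<ge> 1 \<Longrightarrow> y i = y' i"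
  shows "stable y = stable y'"
  unfolding stable_def using assms by simp

lemma stable_SUP:
  assumes "stable y"
  shows "(SUP t\<in>{1..}. ereal ((1 / real t) * (\<Sum>i=1..t. (y i)\<^sup>2))) < \<infinity>"
proof -
  obtain K where K: "\<And>t. t \<ge> 1 \<Longrightarrow> (\<Sum>i=1..t. (y i)\<^sup>2) \<le> real K * real t"
    using assms by (auto simp: stable_def)
  have "(SUP t\<in>{1..}. ereal ((1 / real t) * (\<Sum>i=1..t. (y i)\<^sup>2))) \<le> ereal (real K)"
    using K by (intro SUP_least) (auto simp: field_simps)
  then show ?thesis by (rule order.strict_trans1) simp
qed

context adaptive_law
begin

lemma measurable_stable [measurable]:
  assumes [measurable]: "th \<in> borel_measurable M" "x \<in> measurable M real_seq" "n \<in> measurable M real_seq"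
  shows "Measurable.pred M (\<lambda>\<omega>. stable (traj (th \<omega>) y0 (x \<omega>) (n \<omega>)))"
proof -
  have [measurable]: "(\<lambda>\<omega>. traj (th \<omega>) y0 (x \<omega>) (n \<omega>) t) \<in> borel_measurable M" for t
  proof -
    have "(\<lambda>\<omega>. (th \<omega>, x \<omega>, n \<omega>)) \<in> measurable M (borel \<Otimes>\<^sub>M (real_seq \<Otimes>\<^sub>M real_seq))"
      by measurable
    from measurable_compose[OF this measurable_traj] show ?thesis by simp
  qed
  show ?thesis unfolding stable_def by measurable
qed

text \<open>By Fubini's theorem the random dither can be replaced by a fixed one.  A single choice works
  for every initial value because a change of the initial value amounts to a translation of the
  first noise variable, which preserves null sets.\<close>

lemma fixed_dither:
  fixes N :: "(real ^ 'n) measure"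
  assumes \<sigma>: "\<sigma> > 0" and N: "prob_space N" and sets_N [measurable_cong]: "sets N = sets borel"
    and stable: "\<And>\<theta>. AE p in gauss_seq \<sigma> \<Otimes>\<^sub>M gauss_seq \<sigma>. stable (traj \<theta> 0 (fst p) (snd p))"
  obtains \<xi> where "\<And>y0. AE q in N \<Otimes>\<^sub>M gauss_seq \<sigma>. stable (traj (fst q) y0 \<xi> (snd q))"
proof -
  interpret N: prob_space N by (rule N)
  interpret G: prob_space "gauss_seq \<sigma>" by (intro prob_space_PiM prob_space_gauss \<sigma>)
  interpret SS: pair_prob_space "gauss_seq \<sigma>" "gauss_seq \<sigma>" ..
  interpret NS: pair_prob_space N "gauss_seq \<sigma>" ..
  interpret NSS: pair_sigma_finite N "gauss_seq \<sigma> \<Otimes>\<^sub>M gauss_seq \<sigma>" ..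
  have "AE p in gauss_seq \<sigma> \<Otimes>\<^sub>M gauss_seq \<sigma>. AE \<theta> in N. stable (traj \<theta> 0 (fst p) (snd p))"
    by (subst NSS.AE_commute[symmetric]) (measurable, simp add: stable)
  then have "AE \<xi> in gauss_seq \<sigma>. AE \<eta> in gauss_seq \<sigma>. AE \<theta> in N. stable (traj \<theta> 0 \<xi> \<eta>)"
    using SS.AE_pair by fastforce
  then obtain \<xi> where \<xi>: "AE \<eta> in gauss_seq \<sigma>. AE \<theta> in N. stable (traj \<theta> 0 \<xi> \<eta>)"
    using eventually_happens' G.AE_False by (metis (mono_tags, lifting) eventually_mono)
  have [measurable]: "\<xi> \<in> space real_seq" by (simp add: space_PiM)
  have [measurable]: "snd \<in> measurable (N \<Otimes>\<^sub>M gauss_seq \<sigma>) real_seq"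
    using measurable_snd measurable_cong_sets[OF refl sets_gauss_seq] by blast
  \<comment> \<open>The translation of the first noise depends on \<theta>, so the order is
    exchanged to fix \<theta> first.\<close>
  have fixed: "AE \<theta> in N. AE \<eta> in gauss_seq \<sigma>. stable (traj \<theta> 0 \<xi> \<eta>)"
    by (subst NS.AE_commute) (measurable, rule \<xi>)
  show ?thesis
  proof (rule that[of \<xi>])
    fix y0
    have "AE \<theta> in N. AE \<eta> in gauss_seq \<sigma>. stable (traj \<theta> y0 \<xi> \<eta>)"
      using fixed
    proof eventually_elim
      case (elim \<theta>)
      have "AE \<eta> in gauss_seq \<sigma>. stable (traj \<theta> 0 \<xi> (\<eta>(0 := \<eta> 0 + (\<theta> \<bullet> \<phi> y0 - \<theta> \<bullet> \<phi> 0))))"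
        by (rule AE_gauss_seq_shift[OF \<sigma> _ elim]) measurable
      moreover have "stable (traj \<theta> y0 \<xi> \<eta>) =
          stable (traj \<theta> 0 \<xi> (\<eta>(0 := \<eta> 0 + (\<theta> \<bullet> \<phi> y0 - \<theta> \<bullet> \<phi> 0))))" for \<eta>
        by (rule stable_cong) (simp add: traj_initial_shift[of _ \<theta> y0 \<xi> \<eta> 0] add_diff_eq)
      ultimately show ?case by simp
    qed
    then show "AE q in N \<Otimes>\<^sub>M gauss_seq \<sigma>. stable (traj (fst q) y0 \<xi> (snd q))"
      by (intro NS.AE_pair_measure) simp_all
  qed
qed

text \<open>The law expects an infinite sequence but may see only the outputs up to
  \<open>t\<close>; the padding makes it a function on the finite product.\<close>

definition feedback :: "(nat \<Rightarrow> real) \<Rightarrow> nat \<Rightarrow> (nat \<Rightarrow> real) \<Rightarrow> real" where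
  "feedback \<xi> t y = law \<xi> t (\<lambda>i. if i \<le> t then y i else 0)"

lemma feedback_law_feedback: "feedback_law (feedback \<xi>)"
  unfolding feedback_law_def
proof
  fix t
  have "(\<lambda>y i. if i \<le> t then y i else 0) \<in> measurable (Pi\<^sub>M {..t} (\<lambda>_. borel)) real_seq"
  proof (rule measurable_real_seqI)
    show "(\<lambda>y. if i \<le> t then y i else 0) \<in> borel_measurable (Pi\<^sub>M {..t} (\<lambda>_. borel))" for i
      by (cases "i \<le> t") auto
  qed
  then have "(\<lambda>y. (\<xi>, \<lambda>i. if i \<le> t then y i else 0)) \<in> measurable (Pi\<^sub>M {..t} (\<lambda>_. borel)) (real_seq \<Otimes>\<^sub>M real_seq)"
    by (intro measurable_Pair) (simp_all add: space_PiM)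
  from measurable_compose[OF this measurable_law]
  show "feedback \<xi> t \<in> borel_measurable (Pi\<^sub>M {..t} (\<lambda>_. borel))"
    by (simp add: feedback_def[abs_def])
qed

lemma closed_loop_traj:
  "closed_loop M \<phi> \<theta> w (feedback \<xi>) y0
    (\<lambda>t \<omega>. traj (\<theta> \<omega>) y0 \<xi> (\<lambda>t. w (Suc t) \<omega>) t)
    (\<lambda>t \<omega>. law \<xi> t (traj (\<theta> \<omega>) y0 \<xi> (\<lambda>t. w (Suc t) \<omega>)))"
  unfolding closed_loop_def feedback_def
  by (auto simp: traj_Suc intro!: law_cong)

end

lemma measurable_generated_sigma:
  fixes X :: "'i \<Rightarrow> 'a \<Rightarrow> 'b::topological_space"
  assumes "i \<in> I"
  shows "X i \<in> borel_measurable (generated_sigma M I X)"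
proof (rule measurableI)
  fix A :: "'b set" assume "A \<in> sets borel"
  then have "X i -` A \<inter> space M \<in> (\<Union>i\<in>I. {X i -` A \<inter> space M | A. A \<in> sets borel})"
    using assms by blast
  then show "X i -` A \<inter> space (generated_sigma M I X) \<in> sets (generated_sigma M I X)"
    unfolding generated_sigma_def
    by (subst sets_measure_of, blast, subst space_measure_of, blast) (rule sigma_sets.Basic)
qed auto

section \<open>Stabilization\<close>

text \<open>Independence and identical marginals give a product law on \<open>{1..}\<close>;
  reindexing by \<open>Suc\<close> moves the first noise variable to index 0, the convention of
  \<open>traj\<close>.\<close>

lemma distr_noise:
  assumes "prob_space M" and iid: "iid_gaussian_noise M \<sigma> w"
  shows "\<And>t. w (Suc t) \<in> borel_measurable M"
    and "distr M real_seq (\<lambda>\<omega> t. w (Suc t) \<omega>) = gauss_seq \<sigma>"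
proof -
  interpret prob_space M by fact
  have indep: "indep_vars (\<lambda>_. borel) w {1..}"
    and ident: "\<And>t. t \<ge> 1 \<Longrightarrow> distr M borel (w t) = distr M borel (w 1)"
    and normal: "distributed M lborel (w 1) (\<lambda>x. ennreal (normal_density 0 \<sigma> x))"
    using iid unfolding iid_gaussian_noise_def by blast+
  have meas: "w t \<in> borel_measurable M" if "t \<ge> 1" for t
    using indep that by (auto simp: indep_vars_def)
  then show meas': "\<And>t. w (Suc t) \<in> borel_measurable M" by simp
  have "distr M borel (w 1) = distr M lborel (w 1)" by (intro distr_cong) auto
  then have "distr M borel (w 1) = gauss \<sigma>"
    using normal by (simp add: distributed_def gauss_def)
  then have law: "distr M borel (w t) = gauss \<sigma>" if "t \<ge> 1" for t
    using ident[OF that] by simp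
  have prob: "prob_space (gauss \<sigma>)"
    using law[of 1] prob_space_distr[OF meas[of 1]] by simp
  have "distr M (Pi\<^sub>M {1..} (\<lambda>_. borel)) (\<lambda>\<omega>. \<lambda>i\<in>{1..}. w i \<omega>) = Pi\<^sub>M {1..} (\<lambda>i. distr M borel (w i))"
    using indep by (subst indep_vars_iff_distr_eq_PiM'[symmetric]) (auto intro: meas)
  also have "\<dots> = Pi\<^sub>M {1..} (\<lambda>_. gauss \<sigma>)"
    by (intro PiM_cong refl) (simp add: law)
  finally have joint: "distr M (Pi\<^sub>M {1..} (\<lambda>_. borel)) (\<lambda>\<omega>. \<lambda>i\<in>{1..}. w i \<omega>) = Pi\<^sub>M {1..} (\<lambda>_. gauss \<sigma>)" .
  have "distr M real_seq (\<lambda>\<omega> t. w (Suc t) \<omega>) =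
      distr (distr M (Pi\<^sub>M {1..} (\<lambda>_. borel)) (\<lambda>\<omega>. \<lambda>i\<in>{1..}. w i \<omega>)) real_seq (\<lambda>\<omega> t. \<omega> (Suc t))"
  proof (subst distr_distr)
    show "(\<lambda>\<omega> t. \<omega> (Suc t)) \<in> measurable (Pi\<^sub>M {1..} (\<lambda>_. borel)) real_seq"
      by (rule measurable_real_seqI) simp
    show "(\<lambda>\<omega>. \<lambda>i\<in>{1..}. w i \<omega>) \<in> measurable M (Pi\<^sub>M {1..} (\<lambda>_. borel))"
      by (rule measurable_restrict) (simp add: meas)
  qed (simp add: comp_def)
  also have "\<dots> = distr (Pi\<^sub>M {1..} (\<lambda>_. gauss \<sigma>)) (gauss_seq \<sigma>) (\<lambda>\<omega>. \<lambda>t\<in>UNIV. \<omega> (Suc t))"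
    unfolding joint by (intro distr_cong) (auto simp: sets_gauss_seq)
  also have "\<dots> = gauss_seq \<sigma>"
    by (rule distr_PiM_reindex) (auto intro: prob)
  finally show "distr M real_seq (\<lambda>\<omega> t. w (Suc t) \<omega>) = gauss_seq \<sigma>" .
qed

text \<open>The shifted noise is measurable for the sigma-algebra generated by the noise, so
  independence factors every rectangle, and rectangles determine the product measure.\<close>

lemma distr_parameter_noise:
  fixes \<theta> :: "'a \<Rightarrow> real ^ 'n"
  assumes M: "prob_space M" and iid: "iid_gaussian_noise M \<sigma> w" and param: "gaussian_parameter M \<theta>0 \<theta> w"
  shows "\<theta> \<in> borel_measurable M"
    and "distr M (borel \<Otimes>\<^sub>M real_seq) (\<lambda>\<omega>. (\<theta> \<omega>, \<lambda>t. w (Suc t) \<omega>)) = distr M borel \<theta> \<Otimes>\<^sub>M gauss_seq \<sigma>"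
proof -
  interpret prob_space M by fact
  let ?\<eta> = "\<lambda>\<omega> t. w (Suc t) \<omega>"
  have "\<theta> \<in> measurable M lborel"
    using param by (auto simp: gaussian_parameter_def distributed_def)
  then show \<theta>: "\<theta> \<in> borel_measurable M" by simp
  have \<eta>: "?\<eta> \<in> measurable M real_seq"
    by (rule measurable_real_seqI) (rule distr_noise(1)[OF M iid])
  have space_gen: "space (generated_sigma M {1..} w) = space M"
    unfolding generated_sigma_def by (rule space_measure_of) auto
  have \<eta>_gen: "?\<eta> \<in> measurable (generated_sigma M {1..} w) real_seq"
    by (rule measurable_real_seqI) (rule measurable_generated_sigma, simp)
  have indep: "indep_set (sets (vimage_algebra (space M) \<theta> borel)) (sets (generated_sigma M {1..} w))"
    using param by (simp add: gaussian_parameter_def)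
  have pair [measurable]: "(\<lambda>\<omega>. (\<theta> \<omega>, ?\<eta> \<omega>)) \<in> measurable M (borel \<Otimes>\<^sub>M real_seq)"
    by (rule measurable_Pair[OF \<theta> \<eta>])
  interpret D1: prob_space "distr M borel \<theta>" by (rule prob_space_distr[OF \<theta>])
  interpret D2: prob_space "distr M real_seq ?\<eta>" by (rule prob_space_distr[OF \<eta>])
  have "distr M borel \<theta> \<Otimes>\<^sub>M distr M real_seq ?\<eta> = distr M (borel \<Otimes>\<^sub>M real_seq) (\<lambda>\<omega>. (\<theta> \<omega>, ?\<eta> \<omega>))"
  proof (rule pair_measure_eqI)
    show "sigma_finite_measure (distr M borel \<theta>)" "sigma_finite_measure (distr M real_seq ?\<eta>)"
      by unfold_locales
    fix A B assume "A \<in> sets (distr M borel \<theta>)" "B \<in> sets (distr M real_seq ?\<eta>)"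
    then have A: "A \<in> sets borel" and B: "B \<in> sets real_seq" by simp_all
    have "\<theta> -` A \<inter> space M \<in> sets (vimage_algebra (space M) \<theta> borel)"
      by (rule in_vimage_algebra) (rule A)
    moreover have "?\<eta> -` B \<inter> space M \<in> sets (generated_sigma M {1..} w)"
      using measurable_sets[OF \<eta>_gen B] by (simp only: space_gen)
    ultimately have "prob ((\<theta> -` A \<inter> space M) \<inter> (?\<eta> -` B \<inter> space M)) =
        prob (\<theta> -` A \<inter> space M) * prob (?\<eta> -` B \<inter> space M)"
      by (rule indep_setD[OF indep])
    moreover have "(\<lambda>\<omega>. (\<theta> \<omega>, ?\<eta> \<omega>)) -` (A \<times> B) \<inter> space M = (\<theta> -` A \<inter> space M) \<inter> (?\<eta> -` B \<inter> space M)"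
      by auto
    ultimately show "emeasure (distr M borel \<theta>) A * emeasure (distr M real_seq ?\<eta>) B =
        emeasure (distr M (borel \<Otimes>\<^sub>M real_seq) (\<lambda>\<omega>. (\<theta> \<omega>, ?\<eta> \<omega>))) (A \<times> B)"
      using A B \<theta> \<eta> pair by (simp add: emeasure_distr emeasure_eq_measure flip: ennreal_mult)
  qed simp
  then show "distr M (borel \<Otimes>\<^sub>M real_seq) (\<lambda>\<omega>. (\<theta> \<omega>, ?\<eta> \<omega>)) = distr M borel \<theta> \<Otimes>\<^sub>M gauss_seq \<sigma>"
    by (simp only: distr_noise(2)[OF M iid])
qed

lemma C_k_on_continuous:
  fixes \<phi> :: "real \<Rightarrow> real ^ 'n"
  assumes "k > 0" "\<And>j. C_k_on k (\<lambda>x. \<phi> x $ j) E"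
  shows "continuous_on E \<phi>"
proof -
  have "continuous_on E (\<lambda>x. \<phi> x $ j)" for j
  proof (rule continuous_at_imp_continuous_on, rule ballI)
    fix x assume "x \<in> E"
    then have "((deriv ^^ 0) (\<lambda>x. \<phi> x $ j) has_real_derivative (deriv ^^ Suc 0) (\<lambda>x. \<phi> x $ j) x) (at x)"
      using assms unfolding C_k_on_def by blast
    then show "isCont (\<lambda>x. \<phi> x $ j) x" by (auto dest: DERIV_isCont)
  qed
  then have "continuous_on E (\<lambda>x. \<chi> j. \<phi> x $ j)" by (rule continuous_on_vec_lambda)
  then show ?thesis by simp
qed

lemma dense_sequence:
  obtains D :: "nat \<Rightarrow> 'a::{second_countable_topology, real_normed_vector}"
  where "\<And>v e. e > 0 \<Longrightarrow> \<exists>m. norm (v - D m) \<le> e"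
proof -
  obtain A :: "'a set" where A: "countable A" "\<And>X. open X \<Longrightarrow> X \<noteq> {} \<Longrightarrow> \<exists>d\<in>A. d \<in> X"
    by (rule countable_dense_setE) blast
  have "A \<noteq> {}" using A(2)[of UNIV] by auto
  show ?thesis
  proof (rule that[of "from_nat_into A"])
    fix v :: 'a and e :: real assume "e > 0"
    then obtain d where d: "d \<in> A" "d \<in> ball v e" using A(2)[of "ball v e"] by auto
    then obtain m where "from_nat_into A m = d"
      using from_nat_into_surj[OF A(1)] by metis
    then show "\<exists>m. norm (v - from_nat_into A m) \<le> e"
      using d(2) by (intro exI[of _ m]) (simp add: dist_norm)
  qed
qed

theorem theorem2p2:
  fixes M :: "'a measure"
    and \<phi> :: "real \<Rightarrow> real ^ 'n"
    and \<theta> :: "'a \<Rightarrow> real ^ 'n"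
    and \<theta>0 :: "real ^ 'n"
    and w :: "nat \<Rightarrow> 'a \<Rightarrow> real"
    and \<sigma> L :: real
    and E :: "real set"
  assumes "prob_space M"
    and "CARD('n) \<ge> 2"
    and "\<phi> \<in> borel_measurable borel"
    and "open E"
    and "\<And>j. C_k_on CARD('n) (\<lambda>x. \<phi> x $ j) E"
    and "\<sigma> > 0"
    and A1: "iid_gaussian_noise M \<sigma> w"
    and A2: "gaussian_parameter M \<theta>0 \<theta> w"
    and A3: "components_lin_indep_on \<phi> E"
    and growth: "\<exists>k1>0. \<exists>k2>0. \<forall>x. norm (\<phi> x) \<le> k1 * exp (k2 * \<bar>x\<bar>)"
    and "L > 0"
    and density: "Liminf at_top
           (\<lambda>l::real. ereal (measure lborel ({x. norm (\<phi> x) \<le> L} \<inter> {-l..l}) / l)) > 0"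
  shows "as_globally_stabilizable M \<phi> \<theta> w"
proof -
  interpret prob_space M by fact
  have "continuous_on E \<phi>"
    by (rule C_k_on_continuous[of "CARD('n)"]) (use assms in auto)
  then obtain \<B> :: "real set set" and \<kappa> b r :: real where bins: "finite \<B>" "\<kappa> > 0"
    "\<And>B. B \<in> \<B> \<Longrightarrow> open B" "\<And>B. B \<in> \<B> \<Longrightarrow> B \<noteq> {}" "\<And>B. B \<in> \<B> \<Longrightarrow> B \<subseteq> {-r..r}"
    "\<And>B y. B \<in> \<B> \<Longrightarrow> y \<in> B \<Longrightarrow> norm (\<phi> y) \<le> b"
    "\<And>v. \<exists>B\<in>\<B>. (\<forall>y\<in>B. v \<bullet> \<phi> y \<ge> \<kappa> * norm v) \<or> (\<forall>y\<in>B. v \<bullet> \<phi> y \<le> - \<kappa> * norm v)"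
    by (rule informative_bins[OF \<open>open E\<close> _ A3]) blast
  obtain D :: "nat \<Rightarrow> real ^ 'n" where D: "\<And>v e. e > 0 \<Longrightarrow> \<exists>m. norm (v - D m) \<le> e"
    by (rule dense_sequence) blast
  obtain k1 k2 where k: "k1 > 0" "k2 > 0" "\<And>x. norm (\<phi> x) \<le> k1 * exp (k2 * \<bar>x\<bar>)"
    using growth by blast
  obtain c :: real where c: "0 < c"
    "ereal c < Liminf at_top (\<lambda>l::real. ereal (measure lborel ({x. norm (\<phi> x) \<le> L} \<inter> {-l..l}) / l))"
    using ereal_dense2[OF density] by auto
  then obtain l0 where l0: "\<And>l. l \<ge> l0 \<Longrightarrow> c < measure lborel ({x. norm (\<phi> x) \<le> L} \<inter> {-l..l}) / l"
    using less_LiminfD[OF c(2)] by (auto simp: eventually_at_top_linorder)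
  \<comment> \<open>The maximum with 1 makes \<open>l\<close> positive, so that the quotient can be
    cleared.\<close>
  have dens: "c * l \<le> measure lborel ({x. norm (\<phi> x) \<le> L} \<inter> {-l..l})" if "l \<ge> max 1 l0" for l
    using l0[of l] that by (simp add: pos_less_divide_eq)
  interpret adaptive_law \<phi> L \<B> D
    by unfold_locales (use assms bins in auto)
  \<comment> \<open>Initial value 0 suffices, since \<open>fixed_dither\<close> passes to all
    others.\<close>
  have "AE p in gauss_seq \<sigma> \<Otimes>\<^sub>M gauss_seq \<sigma>. stable (traj \<theta>' 0 (fst p) (snd p))" for \<theta>'
  proof -
    interpret adaptive_loop \<phi> L \<B> D \<theta>' 0 \<sigma> \<kappa> b r k1 k2 c "max 1 l0"
      by unfold_locales (use \<open>L > 0\<close> \<open>\<sigma> > 0\<close> bins D k c dens in auto)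
    show ?thesis using AE_loop_stable by eventually_elim (blast intro: stableI)
  qed
  then obtain \<xi> where \<xi>: "\<And>y0. AE q in distr M borel \<theta> \<Otimes>\<^sub>M gauss_seq \<sigma>. stable (traj (fst q) y0 \<xi> (snd q))"
    by (rule fixed_dither[OF \<open>\<sigma> > 0\<close> prob_space_distr[OF distr_parameter_noise(1)[OF \<open>prob_space M\<close> A1 A2]], rotated])
      auto
  show ?thesis
    unfolding as_globally_stabilizable_def
  proof (intro exI[of _ "feedback \<xi>"] conjI allI feedback_law_feedback)
    fix y0
    define y where "y t \<omega> = traj (\<theta> \<omega>) y0 \<xi> (\<lambda>t. w (Suc t) \<omega>) t" for t \<omega>
    define u where "u t \<omega> = law \<xi> t (traj (\<theta> \<omega>) y0 \<xi> (\<lambda>t. w (Suc t) \<omega>))" for t \<omega>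
    have loop: "closed_loop M \<phi> \<theta> w (feedback \<xi>) y0 y u"
      using closed_loop_traj[of M \<theta> w \<xi> y0] by (simp add: y_def[abs_def] u_def[abs_def])
    have adapted: "u t \<in> borel_measurable (generated_sigma M {..t} y)" for t
    proof -
      have "(\<lambda>\<omega>. \<lambda>i\<in>{..t}. y i \<omega>) \<in> measurable (generated_sigma M {..t} y) (Pi\<^sub>M {..t} (\<lambda>_. borel))"
        by (rule measurable_restrict) (rule measurable_generated_sigma)
      moreover have "feedback \<xi> t \<in> borel_measurable (Pi\<^sub>M {..t} (\<lambda>_. borel))"
        using feedback_law_feedback by (simp add: feedback_law_def)
      ultimately have "(\<lambda>\<omega>. feedback \<xi> t (\<lambda>i\<in>{..t}. y i \<omega>)) \<in> borel_measurable (generated_sigma M {..t} y)"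
        by (rule measurable_compose)
      moreover have "feedback \<xi> t (\<lambda>i\<in>{..t}. y i \<omega>) = u t \<omega>" for \<omega>
        unfolding feedback_def u_def by (rule law_cong) (auto simp: y_def)
      ultimately show ?thesis by simp
    qed
    have "AE \<omega> in M. stable (\<lambda>t. y t \<omega>)"
    proof -
      have meas: "(\<lambda>\<omega>. (\<theta> \<omega>, \<lambda>t. w (Suc t) \<omega>)) \<in> measurable M (borel \<Otimes>\<^sub>M real_seq)"
        by (intro measurable_Pair measurable_real_seqI distr_parameter_noise(1)[OF \<open>prob_space M\<close> A1 A2]
            distr_noise(1)[OF \<open>prob_space M\<close> A1])
      have "AE q in distr M (borel \<Otimes>\<^sub>M real_seq) (\<lambda>\<omega>. (\<theta> \<omega>, \<lambda>t. w (Suc t) \<omega>)). stable (traj (fst q) y0 \<xi> (snd q))"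
        unfolding distr_parameter_noise(2)[OF \<open>prob_space M\<close> A1 A2] by (rule \<xi>)
      from AE_distrD[OF meas this] show ?thesis by (simp add: y_def[abs_def])
    qed
    then have "AE \<omega> in M. (SUP t\<in>{1..}. ereal ((1 / real t) * (\<Sum>i=1..t. (y i \<omega>)\<^sup>2))) < \<infinity>"
      by eventually_elim (rule stable_SUP)
    with loop adapted show "\<exists>y u. closed_loop M \<phi> \<theta> w (feedback \<xi>) y0 y u \<and>
        (\<forall>t. u t \<in> borel_measurable (generated_sigma M {..t} y)) \<and>
        (AE \<omega> in M. (SUP t\<in>{1..}. ereal ((1 / real t) * (\<Sum>i=1..t. (y i \<omega>)\<^sup>2))) < \<infinity>)"
      by blast
  qed
qed

end
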